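(* Let $H$ be a Hilbert space and let $(X,\Sigma,\mu)$, together with a Hilbert space embedding $\alpha:H\subset L^2(X)$, form an (irreducible) Gaussian probability space. Let $B$ denote the set (Boolean algebra) of cylindrical Borel measurable subsets of $H$, let $\mu_0:B\to[0,1]$ be the Gaussian additive function, and let $\widetilde B$ be the reduced abstract $\sigma$-algebra with measure associated with $(B,\mu_0)$. Then there is a canonical isomorphism $$\widetilde B\cong\Sigma/I_\mu.$$
   Context: An abstract $\sigma$-algebra is a Boolean algebra in which countable joins exist. Morphisms of abstract $\sigma$-algebras preserve order, $0$, $1$, complements and countable joins. An additive function on a Boolean algebra $B$ is a function $\mu_0:B\to[0,\infty]$ with $\mu_0(0)=0$ and $\mu_0(a\vee b)=\mu_0(a)+\mu_0(b)$ whenever $a\wedge b=0$. A measure on an abstract $\sigma$-algebra $\Sigma$ is a function $\mu:\Sigma\to[0,\infty]$ with $\mu(0)=0$ and $\mu(\bigvee_{i} a_i)=\sum_{i}\mu(a_i)$ for every sequence $(a_i)$ with $a_i\wedge a_j=0$ for $i\neq j$. An abstract $\sigma$-algebra with a measure $\mu$ is reduced if $\mu(a)=0$ implies $a=0$. For a measure $\mu$ on $\Sigma$, $I_\mu=\{a\in\Sigma:\mu(a)=0\}$, and $\Sigma/I_\mu$ is the quotient abstract $\sigma$-algebra by the relation $a\sim b$ iff the symmetric difference $a\oplus b$ lies in $I_\mu$. For a Boolean algebra $B$ with an additive function $\mu_0:B\to[0,1]$, there is a unique (up to unique isomorphism) morphism of Boolean algebras $\beta:B\to\widetilde B$ where $\widetilde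 B$ is a reduced abstract $\sigma$-algebra with a measure $\widetilde\mu$ such that $\widetilde B$ is generated (as an abstract $\sigma$-algebra) by the image of $\beta$ and $\widetilde\mu\circ\beta=\mu_0$. This is the $\widetilde B$ associated with $(B,\mu_0)$. An (irreducible) Gaussian probability space consists of a Hilbert space $H$, a probability space $(X,\Sigma,\mu)$ and a Hilbert space embedding $\alpha:H\subset L^2(X)$ such that all the random variables in the image of $\alpha$ have centered Gaussian law, and they generate $\Sigma$. Scalars are real. A cylindrical Borel measurable subset of $H$ is a set of the form $\{x\in H:(\langle a_1,x\rangle,\dots,\langle a_n,x\rangle)\in S\}$ with $n\geq 1$, $a_1,\dots,a_n\in H$ and $S\subseteq\mathbb{R}^n$ Borel. The Gaussian additive function $\mu_0$ assigns to this set the measure of $S$ under the centered Gaussian law on $\mathbb{R}^n$ with covariance matrix $(\langle a_i,a_j\rangle)_{i,j}$. *)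

theory Defs
  imports "HOL-Algebra.Lattice" "HOL-Probability.Probability"
begin

unbundle no lattice_syntax

locale boolean_lattice = bounded_lattice +
  assumes meet_join_distrib:
    "\<lbrakk>x \<in> carrier L; y \<in> carrier L; z \<in> carrier L\<rbrakk> \<Longrightarrow> x \<sqinter> (y \<squnion> z) = (x \<sqinter> y) \<squnion> (x \<sqinter> z)"
    and complement_exists:
    "x \<in> carrier L \<Longrightarrow> \<exists>y\<in>carrier L. x \<squnion> y = \<top> \<and> x \<sqinter> y = \<bottom>"

locale abstract_sigma_algebra = boolean_lattice +
  assumes countable_sup_exists:
    "\<lbrakk>A \<subseteq> carrier L; countable A\<rbrakk> \<Longrightarrow> \<exists>s. is_lub L s A"

definition lattice_compl :: "'a gorder \<Rightarrow> 'a \<Rightarrow> 'a" where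
  "lattice_compl L x =
     (THE y. y \<in> carrier L \<and> x \<squnion>\<^bsub>L\<^esub> y = \<top>\<^bsub>L\<^esub> \<and> x \<sqinter>\<^bsub>L\<^esub> y = \<bottom>\<^bsub>L\<^esub>)"

definition boolean_morphism :: "'a gorder \<Rightarrow> 'b gorder \<Rightarrow> ('a \<Rightarrow> 'b) \<Rightarrow> bool" where
  "boolean_morphism K L f \<longleftrightarrow>
     f \<in> carrier K \<rightarrow> carrier L \<and>
     (\<forall>x\<in>carrier K. \<forall>y\<in>carrier K. x \<sqsubseteq>\<^bsub>K\<^esub> y \<longrightarrow> f x \<sqsubseteq>\<^bsub>L\<^esub> f y) \<and>
     f \<bottom>\<^bsub>K\<^esub> = \<bottom>\<^bsub>L\<^esub> \<and> f \<top>\<^bsub>K\<^esub> = \<top>\<^bsub>L\<^esub> \<and>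
     (\<forall>x\<in>carrier K. f (lattice_compl K x) = lattice_compl L (f x)) \<and>
     (\<forall>x\<in>carrier K. \<forall>y\<in>carrier K. f (x \<squnion>\<^bsub>K\<^esub> y) = f x \<squnion>\<^bsub>L\<^esub> f y)"

definition sigma_morphism :: "'a gorder \<Rightarrow> 'b gorder \<Rightarrow> ('a \<Rightarrow> 'b) \<Rightarrow> bool" where
  "sigma_morphism K L f \<longleftrightarrow>
     boolean_morphism K L f \<and>
     (\<forall>A. A \<subseteq> carrier K \<and> countable A \<longrightarrow> f (\<Squnion>\<^bsub>K\<^esub> A) = \<Squnion>\<^bsub>L\<^esub> (f ` A))"

definition sigma_subalgebra :: "'a set \<Rightarrow> 'a gorder \<Rightarrow> bool" where
  "sigma_subalgebra S L \<longleftrightarrow>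
     S \<subseteq> carrier L \<and> \<bottom>\<^bsub>L\<^esub> \<in> S \<and> \<top>\<^bsub>L\<^esub> \<in> S \<and>
     (\<forall>x\<in>S. lattice_compl L x \<in> S) \<and>
     (\<forall>A. A \<subseteq> S \<and> countable A \<longrightarrow> \<Squnion>\<^bsub>L\<^esub> A \<in> S)"

definition sigma_generated_by :: "'a gorder \<Rightarrow> 'a set \<Rightarrow> bool" where
  "sigma_generated_by L G \<longleftrightarrow> (\<forall>S. sigma_subalgebra S L \<and> G \<subseteq> S \<longrightarrow> S = carrier L)"

locale reduced_sigma_algebra = abstract_sigma_algebra L for L :: "'a gorder" (structure) +
  fixes \<mu> :: "'a \<Rightarrow> ennreal"
  assumes measure_bottom: "\<mu> \<bottom> = 0"
    and measure_countably_additive: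
    "\<lbrakk>a \<in> UNIV \<rightarrow> carrier L; \<And>i j :: nat. i \<noteq> j \<Longrightarrow> a i \<sqinter> a j = \<bottom>\<rbrakk>
       \<Longrightarrow> \<mu> (\<Squnion> (range a)) = (\<Sum>i. \<mu> (a i))"
    and reduced: "\<lbrakk>x \<in> carrier L; \<mu> x = 0\<rbrakk> \<Longrightarrow> x = \<bottom>"

definition reduced_sigma_algebra_iso ::
  "'a gorder \<Rightarrow> ('a \<Rightarrow> ennreal) \<Rightarrow> 'b gorder \<Rightarrow> ('b \<Rightarrow> ennreal) \<Rightarrow> ('a \<Rightarrow> 'b) \<Rightarrow> bool" where
  "reduced_sigma_algebra_iso K \<mu> L \<nu> f \<longleftrightarrow>
     sigma_morphism K L f \<and> bij_betw f (carrier K) (carrier L) \<and>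
     (\<forall>x\<in>carrier K. \<nu> (f x) = \<mu> x)"

text \<open>The triple \<open>(L, \<mu>, \<beta>)\<close> is the reduced abstract sigma-algebra with measure associated
  with the Boolean algebra \<open>B\<close> and the additive function \<open>\<mu>\<^sub>0\<close>; it is
  determined by these properties up to a unique isomorphism.\<close>

definition associated_reduced_algebra ::
  "'a gorder \<Rightarrow> ('a \<Rightarrow> ennreal) \<Rightarrow> 'b gorder \<Rightarrow> ('b \<Rightarrow> ennreal) \<Rightarrow> ('a \<Rightarrow> 'b) \<Rightarrow> bool" where
  "associated_reduced_algebra B \<mu>\<^sub>0 L \<mu> \<beta> \<longleftrightarrow>
     reduced_sigma_algebra L \<mu> \<and> boolean_morphism B L \<beta> \<and>
     sigma_generated_by L (\<beta> ` carrier B) \<and> (\<forall>b\<in>carrier B. \<mu> (\<beta> b) = \<mu>\<^sub>0 b)"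

definition null_rel :: "'x measure \<Rightarrow> ('x set \<times> 'x set) set" where
  "null_rel M = {(A, B). A \<in> sets M \<and> B \<in> sets M \<and> sym_diff A B \<in> null_sets M}"

definition null_class :: "'x measure \<Rightarrow> 'x set \<Rightarrow> 'x set set" where
  "null_class M A = null_rel M `` {A}"

definition null_quotient :: "'x measure \<Rightarrow> 'x set set gorder" where
  "null_quotient M =
     \<lparr>carrier = sets M // null_rel M, eq = (=), le = (\<lambda>P Q. \<exists>A\<in>P. \<exists>B\<in>Q. A \<subseteq> B)\<rparr>"

definition null_quotient_measure :: "'x measure \<Rightarrow> 'x set set \<Rightarrow> ennreal" where
  "null_quotient_measure M P = the_elem (emeasure M ` P)"

definition L2_space :: "'x measure \<Rightarrow> ('x \<Rightarrow> real) set set" where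
  "L2_space M =
     {f \<in> borel_measurable M. integrable M (\<lambda>x. (f x)\<^sup>2)} //
     {(f, g). f \<in> borel_measurable M \<and> g \<in> borel_measurable M \<and> (AE x in M. f x = g x)}"

definition L2_embedding :: "'x measure \<Rightarrow> ('h::real_inner \<Rightarrow> ('x \<Rightarrow> real) set) \<Rightarrow> bool" where
  "L2_embedding M \<alpha> \<longleftrightarrow>
     (\<forall>h. \<alpha> h \<in> L2_space M) \<and>
     (\<forall>h k. \<forall>f\<in>\<alpha> h. \<forall>g\<in>\<alpha> k. (\<lambda>x. f x + g x) \<in> \<alpha> (h + k)) \<and>
     (\<forall>c h. \<forall>f\<in>\<alpha> h. (\<lambda>x. c * f x) \<in> \<alpha> (c *\<^sub>R h)) \<and>
     (\<forall>h k. \<forall>f\<in>\<alpha> h. \<forall>g\<in>\<alpha> k. (LINT x|M. f x * g x) = inner h k)"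

text \<open>Variance zero, i.e. the unit mass at 0, is allowed.\<close>

definition centered_gaussian :: "real measure \<Rightarrow> bool" where
  "centered_gaussian N \<longleftrightarrow>
     N = return borel 0 \<or> (\<exists>\<sigma>>0. N = density lborel (normal_density 0 \<sigma>))"

text \<open>The random variables in the image of \<open>\<alpha>\<close> are all the representatives \<open>f \<in> \<alpha> h\<close>.
  Since every indicator function of a null set represents \<open>\<alpha> 0\<close>, the condition
  \<open>generates\<close> is generation of the sigma-algebra up to null sets.\<close>

locale gaussian_probability_space = prob_space M for M :: "'x measure" +
  fixes \<alpha> :: "'h::{real_inner, complete_space} \<Rightarrow> ('x \<Rightarrow> real) set"
  assumes embedding: "L2_embedding M \<alpha>"
    and gaussian: "f \<in> \<alpha> h \<Longrightarrow> centered_gaussian (distr M borel f)"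
    and generates:
    "sets M = sigma_sets (space M)
       {f -` S \<inter> space M | f S. (\<exists>h. f \<in> \<alpha> h) \<and> S \<in> sets borel}"

text \<open>The space \<open>\<real>\<^sup>n\<close> is modelled as the extensional functions on \<open>{..<n}\<close>, as in \<^const>\<open>PiM\<close>.\<close>

abbreviation borel_power :: "nat \<Rightarrow> (nat \<Rightarrow> real) measure" where
  "borel_power n \<equiv> Pi\<^sub>M {..<n} (\<lambda>_. borel)"

definition cylinder :: "nat \<Rightarrow> (nat \<Rightarrow> 'h::real_inner) \<Rightarrow> (nat \<Rightarrow> real) set \<Rightarrow> 'h set" where
  "cylinder n a S = {x. (\<lambda>i\<in>{..<n}. inner (a i) x) \<in> S}"

definition cylinder_algebra :: "'h::real_inner set gorder" where
  "cylinder_algebra =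
     \<lparr>carrier = {cylinder n a S | n a S. n \<ge> 1 \<and> S \<in> sets (borel_power n)},
      eq = (=), le = (\<subseteq>)\<rparr>"

definition is_centered_gaussian_law ::
  "nat \<Rightarrow> (nat \<Rightarrow> nat \<Rightarrow> real) \<Rightarrow> (nat \<Rightarrow> real) measure \<Rightarrow> bool" where
  "is_centered_gaussian_law n C N \<longleftrightarrow>
     sets N = sets (borel_power n) \<and>
     (\<forall>t. centered_gaussian (distr N borel (\<lambda>x. \<Sum>i<n. t i * x i))) \<and>
     (\<forall>i<n. \<forall>j<n. (LINT x|N. x i * x j) = C i j)"

definition centered_gaussian_law :: "nat \<Rightarrow> (nat \<Rightarrow> nat \<Rightarrow> real) \<Rightarrow> (nat \<Rightarrow> real) measure" where
  "centered_gaussian_law n C = (THE N. is_centered_gaussian_law n C N)"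

text \<open>The value does not depend on the presentation of the cylindrical set.\<close>

definition gaussian_additive :: "'h::real_inner set \<Rightarrow> ennreal" where
  "gaussian_additive A =
     (THE r. \<exists>n a S. n \<ge> 1 \<and> S \<in> sets (borel_power n) \<and> A = cylinder n a S \<and>
        r = emeasure (centered_gaussian_law n (\<lambda>i j. inner (a i) (a j))) S)"

end

theory Submission
  imports Defs
begin

text \<open>The quotient \<open>\<Sigma>/I\<^sub>\<mu>\<close> is itself a reduced abstract sigma-algebra, generated by a
  measure-preserving Boolean image of the algebra of cylinders; so it is a completion of the cylinder
  algebra, and any two completions are canonically isomorphic.

  \<^bold>\<open>Two completions of one Boolean algebra are isomorphic\<close> (\<open>associated_reduced_algebra_unique\<close>). Let \<open>L\<close> and
  \<open>K\<close> be completions of \<open>B\<close>. Call \<open>x\<close> in \<open>L\<close> and \<open>y\<close> in \<open>K\<close> matched if for every \<open>\<epsilon> > 0\<close> a single element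
  of \<open>B\<close> is \<open>\<epsilon>\<close>-close to both. Matching respects complements, joins and even countable joins, because
  for a finite measure a countable join is approximated by its finite partial joins
  (\<open>partial_join_close_sup\<close>). Matched elements have the same measure, so by reducedness an element has at
  most one partner; and the elements that have a partner form a sigma-subalgebra containing the image of
  \<open>B\<close>, so all of them have one. Hence matching is the graph of an isomorphism.

  \<^bold>\<open>The null quotient is a completion of the cylinder algebra\<close> (\<open>null_quotient_associated\<close>). The cylinder
  over \<open>S\<close> given by \<open>a\<^sub>1, \<dots>, a\<^sub>n\<close> goes to the class of the event \<open>(f\<^sub>1, \<dots>, f\<^sub>n) \<in> S\<close>, where \<open>f\<^sub>i\<close>
  represents \<open>\<alpha> a\<^sub>i\<close>. A sample point does not determine a vector of \<open>H\<close>, but for finitely many vectors \<open>c\<close> it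
  almost surely looks as if it did: there is a random vector \<open>x\<close> with \<open>\<alpha> c = \<langle>c, x\<rangle>\<close> for all of them
  (\<open>representatives_sampled_by_vector\<close>). So, up to a null set, the event of a cylinder \<open>A\<close> is \<open>x \<in> A\<close>; any
  identity or inclusion between finitely many cylinders is inherited by their events. This gives at once
  independence of the presentation and compatibility with the Boolean operations.

  \<^bold>\<open>The measure of that event is the Gaussian measure of the cylinder.\<close> The vector \<open>(f\<^sub>1, \<dots>, f\<^sub>n)\<close> has a
  centered Gaussian law with the Gram matrix as covariance, and there is only one such law
  (\<open>centered_gaussian_law_unique\<close>): the laws of all linear combinations are determined by their
  variances, these laws determine the characteristic function, and a finite measure on a finite power of
  the line is determined by its characteristic function (\<open>finite_product_char_unique\<close>).\<close>

section \<open>Boolean algebras as ordered sets\<close>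

context boolean_lattice
begin

lemma le_joinI1: "\<lbrakk>x \<sqsubseteq> y; x \<in> carrier L; y \<in> carrier L; z \<in> carrier L\<rbrakk> \<Longrightarrow> x \<sqsubseteq> y \<squnion> z"
  by (rule le_trans[OF _ join_left]) auto

lemma le_joinI2: "\<lbrakk>x \<sqsubseteq> z; x \<in> carrier L; y \<in> carrier L; z \<in> carrier L\<rbrakk> \<Longrightarrow> x \<sqsubseteq> y \<squnion> z"
  by (rule le_trans[OF _ join_right]) auto

lemma complement_unique:
  assumes "x \<in> carrier L" "y \<in> carrier L" "y' \<in> carrier L"
    and "x \<squnion> y = \<top>" "x \<sqinter> y = \<bottom>" "x \<squnion> y' = \<top>" "x \<sqinter> y' = \<bottom>"
  shows "y = y'"
proof -
  have le: "u \<sqsubseteq> v" if "u \<in> carrier L" "v \<in> carrier L" "x \<sqinter> u = \<bottom>" "x \<squnion> v = \<top>" for u v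
  proof -
    have "u = u \<sqinter> (x \<squnion> v)"
      using that le_iff_join[of u \<top>] by simp
    also have "\<dots> = (u \<sqinter> x) \<squnion> (u \<sqinter> v)"
      by (rule meet_join_distrib[OF that(1) assms(1) that(2)])
    also have "\<dots> = \<bottom> \<squnion> (u \<sqinter> v)"
      using that(3) by (simp add: meet_comm)
    also have "\<dots> \<sqsubseteq> v"
      using that by (intro join_le meet_right) auto
    finally show ?thesis .
  qed
  show ?thesis using le[of y y'] le[of y' y] assms by blast
qed

end

text \<open>Complements are formed with \<^const>\<open>lattice_compl\<close>, which takes a plain \<open>'a gorder\<close>; the locale
  \<^locale>\<open>boolean_lattice\<close> also covers records that extend it.\<close>

locale boolean_gorder = boolean_lattice L for L :: "'a gorder" (structure)
begin

lemma lattice_compl_eqI: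
  assumes "x \<in> carrier L" "y \<in> carrier L" "x \<squnion> y = \<top>" "x \<sqinter> y = \<bottom>"
  shows "lattice_compl L x = y"
  unfolding lattice_compl_def using assms complement_unique[OF assms(1)] by (intro the_equality) auto

lemma
  assumes "x \<in> carrier L"
  shows compl_closed [simp]: "lattice_compl L x \<in> carrier L"
    and join_compl [simp]: "x \<squnion> lattice_compl L x = \<top>"
    and meet_compl [simp]: "x \<sqinter> lattice_compl L x = \<bottom>"
  using complement_exists[OF assms] lattice_compl_eqI[OF assms] by auto

lemma compl_compl [simp]: "x \<in> carrier L \<Longrightarrow> lattice_compl L (lattice_compl L x) = x"
  by (intro lattice_compl_eqI) (auto simp: join_comm[of L "lattice_compl L x"] meet_comm[of L "lattice_compl L x"])

text \<open>The residuation law. It turns an inequality involving complements into an equation between joins, and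
  inequalities between differences into inequalities between joins.\<close>

lemma compl_le_iff:
  assumes [simp]: "x \<in> carrier L" "z \<in> carrier L"
  shows "lattice_compl L x \<sqsubseteq> z \<longleftrightarrow> x \<squnion> z = \<top>"
proof
  assume "lattice_compl L x \<sqsubseteq> z"
  then have "x \<squnion> lattice_compl L x \<sqsubseteq> x \<squnion> z"
    by (intro join_le join_left le_joinI2) auto
  then show "x \<squnion> z = \<top>"
    by (intro le_antisym) auto
next
  assume *: "x \<squnion> z = \<top>"
  have "lattice_compl L x = lattice_compl L x \<sqinter> (x \<squnion> z)"
    using le_iff_join[of "lattice_compl L x" \<top>] by (simp add: *)
  also have "\<dots> = \<bottom> \<squnion> (lattice_compl L x \<sqinter> z)"
    by (simp add: meet_join_distrib meet_comm[of L "lattice_compl L x" x])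
  also have "\<dots> \<sqsubseteq> z"
    by (intro join_le meet_right) auto
  finally show "lattice_compl L x \<sqsubseteq> z" .
qed

lemma le_iff_compl_join:
  assumes "x \<in> carrier L" "y \<in> carrier L"
  shows "x \<sqsubseteq> y \<longleftrightarrow> lattice_compl L x \<squnion> y = \<top>"
  using compl_le_iff[of "lattice_compl L x" y] assms by simp

lemma join_assoc:
  "\<lbrakk>x \<in> carrier L; y \<in> carrier L; z \<in> carrier L\<rbrakk> \<Longrightarrow> (x \<squnion> y) \<squnion> z = x \<squnion> (y \<squnion> z)"
  using weak_join_assoc eq_is_equal by simp

lemma join_mono:
  assumes "x \<sqsubseteq> x'" "y \<sqsubseteq> y'"
    and [simp]: "x \<in> carrier L" "y \<in> carrier L" "x' \<in> carrier L" "y' \<in> carrier L"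
  shows "x \<squnion> y \<sqsubseteq> x' \<squnion> y'"
  using assms by (intro join_le) (auto intro: le_joinI1 le_joinI2)

end

text \<open>The difference \<open>x \<sqinter> \<not>y\<close>, written with complement and join only because these are the operations that
  a \<^const>\<open>boolean_morphism\<close> preserves by definition.\<close>

definition lattice_diff :: "'a gorder \<Rightarrow> 'a \<Rightarrow> 'a \<Rightarrow> 'a" where
  "lattice_diff L x y = lattice_compl L (lattice_compl L x \<squnion>\<^bsub>L\<^esub> y)"

context boolean_gorder
begin

lemma diff_closed [simp]: "\<lbrakk>x \<in> carrier L; y \<in> carrier L\<rbrakk> \<Longrightarrow> lattice_diff L x y \<in> carrier L"
  by (simp add: lattice_diff_def)

lemma diff_le_iff:
  assumes "x \<in> carrier L" "y \<in> carrier L" "z \<in> carrier L"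
  shows "lattice_diff L x y \<sqsubseteq> z \<longleftrightarrow> x \<sqsubseteq> y \<squnion> z"
  using assms by (simp add: lattice_diff_def compl_le_iff le_iff_compl_join join_assoc)

lemma le_join_diff:
  assumes "x \<in> carrier L" "y \<in> carrier L"
  shows "x \<sqsubseteq> y \<squnion> lattice_diff L x y"
  using assms by (simp flip: diff_le_iff)

lemma diff_le: "\<lbrakk>x \<in> carrier L; y \<in> carrier L\<rbrakk> \<Longrightarrow> lattice_diff L x y \<sqsubseteq> x"
  by (simp add: diff_le_iff join_right)

lemma meet_diff [simp]:
  assumes [simp]: "x \<in> carrier L" "y \<in> carrier L"
  shows "y \<sqinter> lattice_diff L x y = \<bottom>"
proof (rule bottom_eq)
  let ?d = "lattice_diff L x y" and ?w = "lattice_compl L x \<squnion> y"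
  fix u assume u: "u \<in> carrier L"
  have "y \<sqinter> ?d \<sqsubseteq> ?w \<sqinter> lattice_compl L ?w"
    unfolding lattice_diff_def
    by (intro meet_le meet_right) (auto intro: le_trans[OF meet_left join_right])
  then have "y \<sqinter> ?d \<sqsubseteq> \<bottom>" by simp
  then show "y \<sqinter> ?d \<sqsubseteq> u" using u by (auto intro: le_trans[of _ \<bottom>])
qed auto

lemma diff_self: "x \<in> carrier L \<Longrightarrow> lattice_diff L x x = \<bottom>"
  by (intro le_antisym) (auto simp: diff_le_iff intro: join_left)

lemma diff_eq_bottom_iff:
  assumes "x \<in> carrier L" "y \<in> carrier L"
  shows "lattice_diff L x y = \<bottom> \<longleftrightarrow> x \<sqsubseteq> y"
proof -
  have "y \<squnion> \<bottom> = y"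
    using assms by (metis join_comm bottom_join eq_is_equal)
  then show ?thesis
    using diff_le_iff[OF assms bottom_closed] assms
    by (metis bottom_closed bottom_lower diff_closed le_antisym le_refl)
qed

end


section \<open>Countable joins and finite measures\<close>

context abstract_sigma_algebra
begin

lemma countable_sup_lub:
  assumes "A \<subseteq> carrier L" "countable A"
  shows "is_lub L (\<Squnion>A) A"
  unfolding sup_def using countable_sup_exists[OF assms] by (rule someI_ex)

lemma
  assumes "A \<subseteq> carrier L" "countable A"
  shows countable_sup_closed [simp]: "\<Squnion>A \<in> carrier L"
    and countable_sup_upper: "x \<in> A \<Longrightarrow> x \<sqsubseteq> \<Squnion>A"
    and countable_sup_least: "\<lbrakk>z \<in> carrier L; \<And>x. x \<in> A \<Longrightarrow> x \<sqsubseteq> z\<rbrakk> \<Longrightarrow> \<Squnion>A \<sqsubseteq> z"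
  using countable_sup_lub[OF assms] assms
  by (auto simp: least_def Upper_def)

lemma countable_sup_empty: "\<Squnion>{} = \<bottom>"
  by (rule bottom_eq) (auto intro: countable_sup_least)

lemma countable_sup_eqI:
  assumes "A \<subseteq> carrier L" "countable A" "is_lub L s A"
  shows "\<Squnion>A = s"
  using least_unique[OF countable_sup_lub[OF assms(1,2)] assms(3)] .

end

primrec partial_join :: "'a gorder \<Rightarrow> (nat \<Rightarrow> 'a) \<Rightarrow> nat \<Rightarrow> 'a" where
  "partial_join L x 0 = \<bottom>\<^bsub>L\<^esub>"
| "partial_join L x (Suc n) = partial_join L x n \<squnion>\<^bsub>L\<^esub> x n"

context boolean_gorder
begin

lemma partial_join_closed [simp]: "x \<in> UNIV \<rightarrow> carrier L \<Longrightarrow> partial_join L x n \<in> carrier L"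
  by (induction n) (auto intro!: join_closed)

lemma partial_join_le:
  assumes "x \<in> UNIV \<rightarrow> carrier L" "z \<in> carrier L" "\<And>i. x i \<sqsubseteq> z"
  shows "partial_join L x n \<sqsubseteq> z"
  using assms by (induction n) (auto intro!: join_le)

lemma partial_join_mono:
  assumes "x \<in> UNIV \<rightarrow> carrier L" "m \<le> n"
  shows "partial_join L x m \<sqsubseteq> partial_join L x n"
  using assms(2)
proof (induction n rule: dec_induct)
  case (step k)
  moreover have "x k \<in> carrier L" using assms by auto
  ultimately show ?case
    using assms(1) by (auto intro: le_trans[OF _ join_left])
qed (use assms in auto)

lemma le_partial_join:
  assumes x: "x \<in> UNIV \<rightarrow> carrier L" and "i < n"
  shows "x i \<sqsubseteq> partial_join L x n"
proof -
  have [simp]: "x i \<in> carrier L" using x by auto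
  have "x i \<sqsubseteq> partial_join L x (Suc i)"
    using x by (auto intro: join_right)
  then show ?thesis
    using partial_join_mono[OF x, of "Suc i" n] assms(2) partial_join_closed[OF x] \<open>x i \<in> carrier L\<close>
    by (meson Suc_leI le_trans)
qed

end

sublocale reduced_sigma_algebra \<subseteq> boolean_gorder ..

context reduced_sigma_algebra
begin

lemma measure_join_disjoint:
  assumes [simp]: "x \<in> carrier L" "y \<in> carrier L" and "x \<sqinter> y = \<bottom>"
  shows "\<mu> (x \<squnion> y) = \<mu> x + \<mu> y"
proof -
  \<comment> \<open>Countable additivity applied to the sequence \<open>x, y, \<bottom>, \<bottom>, \<dots>\<close>.\<close>
  define a where "a = (\<lambda>i::nat. if i = 0 then x else if i = 1 then y else \<bottom>)"
  have a: "a \<in> UNIV \<rightarrow> carrier L" by (auto simp: a_def)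
  have bot: "z \<sqinter> \<bottom> = \<bottom>" "\<bottom> \<sqinter> z = \<bottom>" if "z \<in> carrier L" for z
    using that bottom_meet[OF that] eq_is_equal by (auto simp: meet_comm)
  have "a i \<sqinter> a j = \<bottom>" if "i \<noteq> j" for i j
    using that assms bot meet_comm[of L y x] by (auto simp: a_def)
  then have "\<mu> (\<Squnion>(range a)) = (\<Sum>i. \<mu> (a i))"
    by (rule measure_countably_additive[OF a])
  also have "\<dots> = (\<Sum>i\<in>{0,1}. \<mu> (a i))"
    by (rule suminf_finite) (auto simp: a_def measure_bottom)
  also have "\<dots> = \<mu> x + \<mu> y" by (simp add: a_def)
  also have "\<Squnion>(range a) = x \<squnion> y"
  proof (rule le_antisym)
    have cl: "range a \<subseteq> carrier L" using a by auto
    show "\<Squnion>(range a) \<sqsubseteq> x \<squnion> y"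
      by (rule countable_sup_least[OF cl]) (auto simp: a_def join_left join_right)
    have "a 0 \<sqsubseteq> \<Squnion>(range a)" "a 1 \<sqsubseteq> \<Squnion>(range a)"
      by (rule countable_sup_upper[OF cl]; simp)+
    then show "x \<squnion> y \<sqsubseteq> \<Squnion>(range a)"
      by (intro join_le) (use cl in \<open>auto simp: a_def\<close>)
  qed (use a in \<open>auto intro!: countable_sup_closed\<close>)
  finally show ?thesis .
qed

lemma measure_mono:
  assumes "x \<sqsubseteq> y" and [simp]: "x \<in> carrier L" "y \<in> carrier L"
  shows "\<mu> x \<le> \<mu> y"
proof -
  have "y = x \<squnion> lattice_diff L y x"
    using assms by (intro le_antisym join_le le_join_diff diff_le) auto
  then have "\<mu> y = \<mu> x + \<mu> (lattice_diff L y x)"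
    using measure_join_disjoint[of x "lattice_diff L y x"] by simp
  then show ?thesis by simp
qed

lemma measure_join_le:
  assumes [simp]: "x \<in> carrier L" "y \<in> carrier L"
  shows "\<mu> (x \<squnion> y) \<le> \<mu> x + \<mu> y"
proof -
  have "x \<squnion> y \<sqsubseteq> x \<squnion> lattice_diff L y x"
    by (intro join_le join_left le_join_diff) auto
  then have "\<mu> (x \<squnion> y) \<le> \<mu> (x \<squnion> lattice_diff L y x)"
    by (rule measure_mono) auto
  also have "\<dots> = \<mu> x + \<mu> (lattice_diff L y x)"
    by (rule measure_join_disjoint) auto
  also have "\<dots> \<le> \<mu> x + \<mu> y"
    by (intro add_left_mono measure_mono diff_le) auto
  finally show ?thesis .
qed

text \<open>The values \<open>a\<^sub>n = x\<^sub>n \<sqinter> \<not>(x\<^sub>0 \<squnion> \<dots> \<squnion> x\<^sub>n\<^sub>-\<^sub>1)\<close> are pairwise disjoint, so their measures have a finite sum,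
  and the tails of this series tend to zero. The join of the \<open>a\<^sub>i\<close> with \<open>i \<ge> n\<close> is the error term. Bounding
  the countable join by a finite one joined with this error avoids any infinite distributive law.\<close>

lemma sup_le_partial_join_small:
  assumes x: "x \<in> UNIV \<rightarrow> carrier L" and fin: "\<mu> \<top> \<noteq> \<infinity>" and e: "e > 0"
  shows "\<exists>n. \<exists>z\<in>carrier L. \<mu> z < e \<and> \<Squnion>(range x) \<sqsubseteq> partial_join L x n \<squnion> z"
proof -
  let ?P = "partial_join L x"
  define a where "a = (\<lambda>n. lattice_diff L (x n) (?P n))"
  have xc [simp]: "x i \<in> carrier L" for i using x by auto
  have Pc [simp]: "?P i \<in> carrier L" for i using x by auto
  have ac [simp]: "a i \<in> carrier L" for i by (simp add: a_def)
  \<comment> \<open>It suffices to treat \<open>i < j\<close>: then \<open>a i\<close> lies below the partial join that \<open>a j\<close> avoids.\<close>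
  have disj_less: "a i \<sqinter> a j = \<bottom>" if "i < j" for i j
  proof (rule bottom_eq)
    have "a i \<sqsubseteq> ?P j"
      using le_trans[OF diff_le le_partial_join[OF x that]] by (simp add: a_def)
    then have "a i \<sqinter> a j \<sqsubseteq> ?P j \<sqinter> a j"
      by (intro meet_le meet_right) (auto intro: le_trans[OF meet_left])
    also have "?P j \<sqinter> a j = \<bottom>" by (simp add: a_def)
    finally have "a i \<sqinter> a j \<sqsubseteq> \<bottom>" .
    then show "a i \<sqinter> a j \<sqsubseteq> u" if "u \<in> carrier L" for u
      using that by (auto intro: le_trans[of _ \<bottom>])
  qed auto
  have disj: "a i \<sqinter> a j = \<bottom>" if "i \<noteq> j" for i j
    using that disj_less[of i j] disj_less[of j i] by (cases "i < j") (auto simp: meet_comm[of L "a i"])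
  have ra: "range (\<lambda>i. a (i + n)) \<subseteq> carrier L" for n by auto
  define z where "z = (\<lambda>n. \<Squnion>(range (\<lambda>i. a (i + n))))"
  have zc [simp]: "z n \<in> carrier L" for n
    unfolding z_def by (intro countable_sup_closed) auto
  have \<mu>z: "\<mu> (z n) = (\<Sum>i. \<mu> (a (i + n)))" for n
    unfolding z_def by (rule measure_countably_additive) (auto intro!: disj)
  have "(\<Sum>i. \<mu> (a i)) = \<mu> (z 0)" using \<mu>z[of 0] by simp
  also have "\<dots> \<le> \<mu> \<top>" by (intro measure_mono) auto
  finally have S: "(\<Sum>i. \<mu> (a i)) \<noteq> \<infinity>" using fin by (auto simp: top_unique)
  \<comment> \<open>Choose \<open>n\<close> with \<open>\<Sum>\<^sub>i \<mu> (a i) < \<Sum>\<^sub>i\<^sub><\<^sub>n \<mu> (a i) + e\<close>; cancelling the finite partial sum bounds the tail by \<open>e\<close>.\<close>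
  have "(\<lambda>n. (\<Sum>i<n. \<mu> (a i)) + e) \<longlonglongrightarrow> (\<Sum>i. \<mu> (a i)) + e"
    by (intro tendsto_add summable_LIMSEQ) auto
  moreover have "(\<Sum>i. \<mu> (a i)) + 0 < (\<Sum>i. \<mu> (a i)) + e"
    using S e by (subst ennreal_add_left_cancel_less) auto
  ultimately have "eventually (\<lambda>n. (\<Sum>i. \<mu> (a i)) < (\<Sum>i<n. \<mu> (a i)) + e) sequentially"
    by (intro order_tendstoD) auto
  then obtain n where n: "(\<Sum>i. \<mu> (a i)) < (\<Sum>i<n. \<mu> (a i)) + e"
    by (auto simp: eventually_sequentially)
  have "(\<Sum>i. \<mu> (a i)) = (\<Sum>i<n. \<mu> (a i)) + \<mu> (z n)"
    unfolding \<mu>z using suminf_offset[of "\<lambda>i. \<mu> (a i)" n] by (simp add: add.commute)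
  with n have "\<mu> (z n) < e" by (simp add: ennreal_add_left_cancel_less)
  moreover have "\<Squnion>(range x) \<sqsubseteq> ?P n \<squnion> z n"
  proof (rule countable_sup_least)
    have az: "a k \<sqsubseteq> z n" if "n \<le> k" for k
      unfolding z_def using that by (intro countable_sup_upper) (auto intro!: image_eqI[of _ _ "k - n"])
    have step: "x k \<sqsubseteq> ?P k \<squnion> a k" for k by (simp add: a_def le_join_diff)
    have P: "?P k \<sqsubseteq> ?P n \<squnion> z n" for k
    proof (induction k)
      case (Suc k)
      show ?case
      proof (cases "k < n")
        case True
        then show ?thesis
          using partial_join_mono[OF x, of "Suc k" n] by (auto intro!: le_trans[OF _ join_left] simp del: partial_join.simps)
      next
        case False
        have "?P k \<squnion> a k \<sqsubseteq> ?P n \<squnion> z n"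
          using Suc False by (intro join_le) (auto intro: le_trans[OF az join_right])
        then show ?thesis
          using Suc step[of k] by (auto intro!: join_le intro: le_trans)
      qed
    qed auto
    fix u assume "u \<in> range x"
    then obtain k where k: "u = x k" by auto
    show "u \<sqsubseteq> ?P n \<squnion> z n"
      using P[of "Suc k"] le_partial_join[OF x, of k "Suc k"] unfolding k
      by (auto intro: le_trans simp del: partial_join.simps)
  qed auto
  ultimately show ?thesis by (intro exI[of _ n] bexI[of _ "z n"]) auto
qed

end

text \<open>The relation \<open>\<mu>(x \<oplus> y) < e\<close>, with the symmetric difference replaced by an arbitrary common error term \<open>z\<close>.
  In this form the triangle inequality and the compatibility with joins follow by joining error terms.\<close>

definition close_within :: "'a gorder \<Rightarrow> ('a \<Rightarrow> ennreal) \<Rightarrow> real \<Rightarrow> 'a \<Rightarrow> 'a \<Rightarrow> bool" where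
  "close_within L \<mu> e x y \<longleftrightarrow>
     (\<exists>z\<in>carrier L. \<mu> z < ennreal e \<and> x \<sqsubseteq>\<^bsub>L\<^esub> y \<squnion>\<^bsub>L\<^esub> z \<and> y \<sqsubseteq>\<^bsub>L\<^esub> x \<squnion>\<^bsub>L\<^esub> z)"

context reduced_sigma_algebra
begin

abbreviation "close \<equiv> close_within L \<mu>"

lemma close_self: "\<lbrakk>x \<in> carrier L; e > 0\<rbrakk> \<Longrightarrow> close e x x"
  unfolding close_within_def by (intro bexI[of _ \<bottom>]) (auto simp: measure_bottom join_left)

lemma measure_le_if_close:
  assumes "close e x y" and [simp]: "x \<in> carrier L" "y \<in> carrier L" "0 \<le> e"
  shows "\<mu> x \<le> \<mu> y + ennreal e"  "\<mu> y \<le> \<mu> x + ennreal e"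
proof -
  obtain z where z [simp]: "z \<in> carrier L" "\<mu> z < ennreal e" and le: "x \<sqsubseteq> y \<squnion> z" "y \<sqsubseteq> x \<squnion> z"
    using assms(1) by (auto simp: close_within_def)
  have "\<mu> x \<le> \<mu> y + \<mu> z" "\<mu> y \<le> \<mu> x + \<mu> z"
    by (rule order_trans[OF measure_mono[OF le(1)] measure_join_le]
        order_trans[OF measure_mono[OF le(2)] measure_join_le]; simp)+
  moreover have "\<mu> z \<le> ennreal e" using z(2) by (rule less_imp_le)
  ultimately show "\<mu> x \<le> \<mu> y + ennreal e"  "\<mu> y \<le> \<mu> x + ennreal e"
    by (auto elim!: order_trans intro: add_left_mono)
qed

lemma measure_join_less:
  assumes "w \<in> carrier L" "z \<in> carrier L" "\<mu> w < ennreal d" "\<mu> z < ennreal e"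
  shows "\<mu> (w \<squnion> z) < ennreal (d + e)"
proof -
  have pos: "0 < d" "0 < e"
    using le_less_trans[OF zero_le assms(3)] le_less_trans[OF zero_le assms(4)] by simp_all
  have "\<mu> (w \<squnion> z) \<le> \<mu> w + \<mu> z" using measure_join_le assms by simp
  also have "\<dots> < ennreal d + ennreal e" by (intro add_strict_mono assms)
  also have "\<dots> = ennreal (d + e)" using pos by simp
  finally show ?thesis .
qed

lemma close_trans:
  assumes "close d x y" "close e y u" and [simp]: "x \<in> carrier L" "y \<in> carrier L" "u \<in> carrier L"
  shows "close (d + e) x u"
proof -
  obtain w where [simp]: "w \<in> carrier L" and w: "\<mu> w < ennreal d" "x \<sqsubseteq> y \<squnion> w" "y \<sqsubseteq> x \<squnion> w"
    using assms(1) by (auto simp: close_within_def)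
  obtain z where [simp]: "z \<in> carrier L" and z: "\<mu> z < ennreal e" "y \<sqsubseteq> u \<squnion> z" "u \<sqsubseteq> y \<squnion> z"
    using assms(2) by (auto simp: close_within_def)
  have "x \<sqsubseteq> (u \<squnion> z) \<squnion> w" "u \<sqsubseteq> (x \<squnion> w) \<squnion> z"
    using le_trans[OF w(2) join_mono[OF z(2) le_refl]] le_trans[OF z(3) join_mono[OF w(3) le_refl]] by auto
  then have "x \<sqsubseteq> u \<squnion> (w \<squnion> z)" "u \<sqsubseteq> x \<squnion> (w \<squnion> z)"
    by (simp_all add: join_assoc join_comm[of L z w])
  then show ?thesis
    unfolding close_within_def using measure_join_less[OF _ _ w(1) z(1)] by (intro bexI[of _ "w \<squnion> z"]) auto
qed

lemma close_join:
  assumes "close d x y" "close e x' y'"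
    and [simp]: "x \<in> carrier L" "y \<in> carrier L" "x' \<in> carrier L" "y' \<in> carrier L"
  shows "close (d + e) (x \<squnion> x') (y \<squnion> y')"
proof -
  obtain w where [simp]: "w \<in> carrier L" and w: "\<mu> w < ennreal d" "x \<sqsubseteq> y \<squnion> w" "y \<sqsubseteq> x \<squnion> w"
    using assms(1) by (auto simp: close_within_def)
  obtain z where [simp]: "z \<in> carrier L" and z: "\<mu> z < ennreal e" "x' \<sqsubseteq> y' \<squnion> z" "y' \<sqsubseteq> x' \<squnion> z"
    using assms(2) by (auto simp: close_within_def)
  have "x \<squnion> x' \<sqsubseteq> (y \<squnion> y') \<squnion> (w \<squnion> z)"
    by (intro join_le le_trans[OF w(2) join_mono[OF join_left join_left]]
        le_trans[OF z(2) join_mono[OF join_right join_right]]) auto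
  moreover have "y \<squnion> y' \<sqsubseteq> (x \<squnion> x') \<squnion> (w \<squnion> z)"
    by (intro join_le le_trans[OF w(3) join_mono[OF join_left join_left]]
        le_trans[OF z(3) join_mono[OF join_right join_right]]) auto
  ultimately show ?thesis
    unfolding close_within_def using measure_join_less[OF _ _ w(1) z(1)] by (intro bexI[of _ "w \<squnion> z"]) auto
qed

lemma close_compl:
  assumes "close e x y" and [simp]: "x \<in> carrier L" "y \<in> carrier L"
  shows "close e (lattice_compl L x) (lattice_compl L y)"
proof -
  have "lattice_compl L u \<sqsubseteq> lattice_compl L v \<squnion> z"
    if "v \<sqsubseteq> u \<squnion> z" "u \<in> carrier L" "v \<in> carrier L" "z \<in> carrier L" for u v z
  proof -
    have "u \<squnion> (lattice_compl L v \<squnion> z) = lattice_compl L v \<squnion> (u \<squnion> z)"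
      using that join_assoc[of u "lattice_compl L v" z] join_assoc[of "lattice_compl L v" u z]
      by (simp add: join_comm[of L u "lattice_compl L v"])
    then show ?thesis
      using that by (simp add: compl_le_iff le_iff_compl_join)
  qed
  then show ?thesis
    using assms by (auto simp: close_within_def)
qed

lemma partial_join_close_sup:
  assumes x: "x \<in> UNIV \<rightarrow> carrier L" and fin: "\<mu> \<top> \<noteq> \<infinity>" and e: "e > 0"
  shows "\<exists>m. \<forall>n\<ge>m. close e (\<Squnion>(range x)) (partial_join L x n)"
proof -
  have sc [simp]: "\<Squnion>(range x) \<in> carrier L" using x by (intro countable_sup_closed) auto
  obtain m z where [simp]: "z \<in> carrier L" and z: "\<mu> z < ennreal e" "\<Squnion>(range x) \<sqsubseteq> partial_join L x m \<squnion> z"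
    using sup_le_partial_join_small[OF x fin, of "ennreal e"] e by auto
  have "close e (\<Squnion>(range x)) (partial_join L x n)" if "n \<ge> m" for n
    unfolding close_within_def
  proof (intro bexI[of _ z] conjI)
    show "\<Squnion>(range x) \<sqsubseteq> partial_join L x n \<squnion> z"
      using x by (intro le_trans[OF z(2) join_mono[OF partial_join_mono[OF x that]]]) auto
    have "partial_join L x n \<sqsubseteq> \<Squnion>(range x)"
      using x by (intro partial_join_le countable_sup_upper) auto
    then show "partial_join L x n \<sqsubseteq> \<Squnion>(range x) \<squnion> z"
      using x by (auto intro!: le_trans[OF _ join_left])
  qed (use z in auto)
  then show ?thesis by auto
qed

end

section \<open>Uniqueness of the completion of a Boolean algebra with measure\<close>

text \<open>The additive function on \<open>B\<close> is encoded by the equality of the two measures on the image of \<open>B\<close>. This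
  keeps the situation symmetric in \<open>L\<close> and \<open>K\<close>, and bijectivity follows from \<open>swap\<close>.\<close>

locale two_completions =
  B: boolean_gorder B + L: reduced_sigma_algebra L \<mu> + K: reduced_sigma_algebra K \<nu>
  for B :: "'a gorder" and L :: "'b gorder" and \<mu> and K :: "'c gorder" and \<nu> +
  fixes \<beta> :: "'a \<Rightarrow> 'b" and \<gamma> :: "'a \<Rightarrow> 'c"
  assumes \<beta>: "boolean_morphism B L \<beta>" and \<gamma>: "boolean_morphism B K \<gamma>"
    and gen_\<beta>: "sigma_generated_by L (\<beta> ` carrier B)"
    and gen_\<gamma>: "sigma_generated_by K (\<gamma> ` carrier B)"
    and measures_agree: "b \<in> carrier B \<Longrightarrow> \<mu> (\<beta> b) = \<nu> (\<gamma> b)"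
    and finite_measure: "\<mu> \<top>\<^bsub>L\<^esub> \<noteq> \<infinity>"
begin

lemma swap: "two_completions B K \<nu> L \<mu> \<gamma> \<beta>"
proof -
  have "\<nu> \<top>\<^bsub>K\<^esub> = \<mu> \<top>\<^bsub>L\<^esub>"
    using measures_agree[of "\<top>\<^bsub>B\<^esub>"] \<beta> \<gamma> by (simp add: boolean_morphism_def)
  then show ?thesis
    using \<beta> \<gamma> gen_\<beta> gen_\<gamma> measures_agree finite_measure
    by unfold_locales auto
qed

text \<open>Both completions are closures of \<open>B\<close> for the metric \<open>\<mu>(x \<oplus> y)\<close>; matched elements are the limits of a
  common sequence in \<open>B\<close>.\<close>

definition matched :: "'b \<Rightarrow> 'c \<Rightarrow> bool" where
  "matched x y \<longleftrightarrow> x \<in> carrier L \<and> y \<in> carrier K \<and>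
     (\<forall>e>0. \<exists>b\<in>carrier B. close_within L \<mu> e x (\<beta> b) \<and> close_within K \<nu> e y (\<gamma> b))"

lemma \<beta>_closed [simp]: "b \<in> carrier B \<Longrightarrow> \<beta> b \<in> carrier L"
  and \<gamma>_closed [simp]: "b \<in> carrier B \<Longrightarrow> \<gamma> b \<in> carrier K"
  using \<beta> \<gamma> by (auto simp: boolean_morphism_def)

lemma \<beta>_compl: "b \<in> carrier B \<Longrightarrow> \<beta> (lattice_compl B b) = lattice_compl L (\<beta> b)"
  and \<gamma>_compl: "b \<in> carrier B \<Longrightarrow> \<gamma> (lattice_compl B b) = lattice_compl K (\<gamma> b)"
  and \<beta>_join: "\<lbrakk>b \<in> carrier B; b' \<in> carrier B\<rbrakk> \<Longrightarrow> \<beta> (b \<squnion>\<^bsub>B\<^esub> b') = \<beta> b \<squnion>\<^bsub>L\<^esub> \<beta> b'"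
  and \<gamma>_join: "\<lbrakk>b \<in> carrier B; b' \<in> carrier B\<rbrakk> \<Longrightarrow> \<gamma> (b \<squnion>\<^bsub>B\<^esub> b') = \<gamma> b \<squnion>\<^bsub>K\<^esub> \<gamma> b'"
  using \<beta> \<gamma> by (auto simp: boolean_morphism_def)

lemma matched_closed: "matched x y \<Longrightarrow> x \<in> carrier L" "matched x y \<Longrightarrow> y \<in> carrier K"
  by (auto simp: matched_def)

lemma matched_approx:
  assumes "matched x y" "e > 0"
  obtains b where "b \<in> carrier B" "close_within L \<mu> e x (\<beta> b)" "close_within K \<nu> e y (\<gamma> b)"
  using assms unfolding matched_def by blast

lemma matched_image: "b \<in> carrier B \<Longrightarrow> matched (\<beta> b) (\<gamma> b)"
  unfolding matched_def by (auto intro!: bexI[of _ b] L.close_self K.close_self)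

lemma matched_bottom: "matched \<bottom>\<^bsub>L\<^esub> \<bottom>\<^bsub>K\<^esub>"
  and matched_top: "matched \<top>\<^bsub>L\<^esub> \<top>\<^bsub>K\<^esub>"
  using matched_image[of "\<bottom>\<^bsub>B\<^esub>"] matched_image[of "\<top>\<^bsub>B\<^esub>"] \<beta> \<gamma> by (simp_all add: boolean_morphism_def)

lemma matched_compl:
  assumes "matched x y"
  shows "matched (lattice_compl L x) (lattice_compl K y)"
  unfolding matched_def
proof (intro conjI allI impI)
  fix e :: real assume "e > 0"
  then obtain b where b: "b \<in> carrier B" "close_within L \<mu> e x (\<beta> b)" "close_within K \<nu> e y (\<gamma> b)"
    using matched_approx[OF assms] by blast
  then show "\<exists>b\<in>carrier B. close_within L \<mu> e (lattice_compl L x) (\<beta> b) \<and>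
      close_within K \<nu> e (lattice_compl K y) (\<gamma> b)"
    using L.close_compl[OF b(2)] K.close_compl[OF b(3)] matched_closed[OF assms]
    by (intro bexI[of _ "lattice_compl B b"]) (auto simp: \<beta>_compl \<gamma>_compl)
qed (use matched_closed[OF assms] in auto)

lemma matched_join:
  assumes "matched x y" "matched x' y'"
  shows "matched (x \<squnion>\<^bsub>L\<^esub> x') (y \<squnion>\<^bsub>K\<^esub> y')"
  unfolding matched_def
proof (intro conjI allI impI)
  fix e :: real assume "e > 0"
  then have h: "e/2 > 0" by simp
  obtain b where b: "b \<in> carrier B" "close_within L \<mu> (e/2) x (\<beta> b)" "close_within K \<nu> (e/2) y (\<gamma> b)"
    using matched_approx[OF assms(1) h] .
  obtain b' where b': "b' \<in> carrier B" "close_within L \<mu> (e/2) x' (\<beta> b')" "close_within K \<nu> (e/2) y' (\<gamma> b')"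
    using matched_approx[OF assms(2) h] .
  show "\<exists>b\<in>carrier B. close_within L \<mu> e (x \<squnion>\<^bsub>L\<^esub> x') (\<beta> b) \<and>
      close_within K \<nu> e (y \<squnion>\<^bsub>K\<^esub> y') (\<gamma> b)"
    using L.close_join[OF b(2) b'(2)] K.close_join[OF b(3) b'(3)]
      matched_closed[OF assms(1)] matched_closed[OF assms(2)] b(1) b'(1)
    by (intro bexI[of _ "b \<squnion>\<^bsub>B\<^esub> b'"]) (auto simp: \<beta>_join \<gamma>_join)
qed (use matched_closed[OF assms(1)] matched_closed[OF assms(2)] in auto)

text \<open>Half of the error is spent on replacing the two countable joins by partial joins of the same length, the
  other half on a common approximation of these two partial joins.\<close>

lemma matched_sup:
  fixes x :: "nat \<Rightarrow> 'b" and y :: "nat \<Rightarrow> 'c"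
  assumes xy: "\<And>i. matched (x i) (y i)"
  shows "matched (\<Squnion>\<^bsub>L\<^esub> (range x)) (\<Squnion>\<^bsub>K\<^esub> (range y))"
  unfolding matched_def
proof (intro conjI allI impI)
  have x: "x \<in> UNIV \<rightarrow> carrier L" and y: "y \<in> UNIV \<rightarrow> carrier K"
    using xy by (auto simp: matched_def)
  have ran: "range x \<subseteq> carrier L" "range y \<subseteq> carrier K"
    using matched_closed[OF xy] by auto
  show sc: "\<Squnion>\<^bsub>L\<^esub> (range x) \<in> carrier L"
    using ran by (intro L.countable_sup_closed) auto
  show sc': "\<Squnion>\<^bsub>K\<^esub> (range y) \<in> carrier K"
    using ran by (intro K.countable_sup_closed) auto
  have P: "matched (partial_join L x n) (partial_join K y n)" for n
    using xy by (induction n) (auto intro: matched_bottom matched_join)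
  fix e :: real assume "e > 0"
  then have "e/2 > 0" by simp
  have "\<nu> \<top>\<^bsub>K\<^esub> \<noteq> \<infinity>" using swap by (simp add: two_completions_def two_completions_axioms_def)
  then obtain m m' where
    "\<forall>n\<ge>m. close_within L \<mu> (e/2) (\<Squnion>\<^bsub>L\<^esub> (range x)) (partial_join L x n)"
    "\<forall>n\<ge>m'. close_within K \<nu> (e/2) (\<Squnion>\<^bsub>K\<^esub> (range y)) (partial_join K y n)"
    using L.partial_join_close_sup[OF x finite_measure \<open>e/2 > 0\<close>]
      K.partial_join_close_sup[OF y _ \<open>e/2 > 0\<close>] by blast
  moreover define n where "n = max m m'"
  ultimately have c: "close_within L \<mu> (e/2) (\<Squnion>\<^bsub>L\<^esub> (range x)) (partial_join L x n)"
    "close_within K \<nu> (e/2) (\<Squnion>\<^bsub>K\<^esub> (range y)) (partial_join K y n)" by auto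
  obtain b where b: "b \<in> carrier B" "close_within L \<mu> (e/2) (partial_join L x n) (\<beta> b)"
     "close_within K \<nu> (e/2) (partial_join K y n) (\<gamma> b)"
    using matched_approx[OF P \<open>e/2 > 0\<close>] .
  show "\<exists>b\<in>carrier B. close_within L \<mu> e (\<Squnion>\<^bsub>L\<^esub> (range x)) (\<beta> b) \<and> close_within K \<nu> e (\<Squnion>\<^bsub>K\<^esub> (range y)) (\<gamma> b)"
    using L.close_trans[OF c(1) b(2)] K.close_trans[OF c(2) b(3)] b(1) sc sc' x y
    by (intro bexI[of _ b] conjI) (simp_all add: Pi_iff)
qed

lemma matched_measure:
  assumes "matched x y"
  shows "\<mu> x = \<nu> y"
proof -
  have *: "\<mu> x \<le> \<nu> y + ennreal e \<and> \<nu> y \<le> \<mu> x + ennreal e" if e: "e > 0" for e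
  proof -
    obtain b where b: "b \<in> carrier B" "close_within L \<mu> (e/2) x (\<beta> b)" "close_within K \<nu> (e/2) y (\<gamma> b)"
      using matched_approx[OF assms half_gt_zero[OF e]] .
    have e2: "ennreal e = ennreal (e/2) + ennreal (e/2)"
      using e by (subst ennreal_plus[symmetric]) simp_all
    have x: "x \<in> carrier L" and y: "y \<in> carrier K" using assms by (rule matched_closed)+
    have \<beta>b: "\<beta> b \<in> carrier L" and \<gamma>b: "\<gamma> b \<in> carrier K" using b(1) by simp_all
    have e0: "0 \<le> e/2" using e by simp
    note L = L.measure_le_if_close[OF b(2) x \<beta>b e0, unfolded measures_agree[OF b(1)]]
    note K = K.measure_le_if_close[OF b(3) y \<gamma>b e0]
    show ?thesis
      using order_trans[OF L(1) add_right_mono[OF K(2)]] order_trans[OF K(1) add_right_mono[OF L(2)]]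
      by (simp only: e2 add.assoc)
  qed
  show ?thesis
    by (rule antisym; rule ennreal_le_epsilon) (simp_all add: *)
qed

text \<open>If \<open>x\<close> is matched with \<open>y\<close> and \<open>y'\<close>, then \<open>\<bottom> = x \<sqinter> \<not>x\<close> is matched with \<open>y \<sqinter> \<not>y'\<close>, which therefore has measure
  zero and vanishes because \<open>K\<close> is reduced.\<close>

lemma matched_unique:
  assumes "matched x y" "matched x y'"
  shows "y = y'"
proof -
  have le: "y \<sqsubseteq>\<^bsub>K\<^esub> y'" if "matched x y" "matched x y'" for y y'
  proof -
    have "matched (lattice_diff L x x) (lattice_diff K y y')"
      unfolding lattice_diff_def by (intro matched_compl matched_join that)
    then have "\<nu> (lattice_diff K y y') = 0"
      using matched_measure[of "lattice_diff L x x"] that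
      by (simp add: matched_def L.diff_self L.measure_bottom)
    then have "lattice_diff K y y' = \<bottom>\<^bsub>K\<^esub>"
      using that by (intro K.reduced) (auto simp: matched_def)
    then show ?thesis using that K.diff_eq_bottom_iff by (auto simp: matched_def)
  qed
  show ?thesis
    using le assms by (intro K.le_antisym) (auto simp: matched_def)
qed

text \<open>The elements with a partner form a sigma-subalgebra that contains the generators.\<close>

lemma matched_exists:
  assumes "x \<in> carrier L"
  shows "\<exists>y. matched x y"
proof -
  let ?S = "{x. \<exists>y. matched x y}"
  have "sigma_subalgebra ?S L"
    unfolding sigma_subalgebra_def
  proof (intro conjI ballI allI impI)
    fix A assume A: "A \<subseteq> ?S \<and> countable A"
    show "\<Squnion>\<^bsub>L\<^esub> A \<in> ?S"
    proof (cases "A = {}")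
      case True
      then show ?thesis using matched_bottom L.countable_sup_empty by auto
    next
      case False
      with A obtain x :: "nat \<Rightarrow> 'b" where x: "A = range x" using range_from_nat_into[of A] by metis
      with A have "\<forall>i. \<exists>y. matched (x i) y" by auto
      then obtain y where "\<And>i. matched (x i) (y i)" by metis
      then have "matched (\<Squnion>\<^bsub>L\<^esub> A) (\<Squnion>\<^bsub>K\<^esub> (range y))" unfolding x by (rule matched_sup)
      then show ?thesis by auto
    qed
  qed (use matched_bottom matched_top matched_compl matched_closed in blast)+
  moreover have "\<beta> ` carrier B \<subseteq> ?S" using matched_image by auto
  ultimately have "?S = carrier L" using gen_\<beta> by (auto simp: sigma_generated_by_def)
  then show ?thesis using assms by auto
qed

lemma swap_matched: "two_completions.matched B K \<nu> L \<mu> \<gamma> \<beta> y x \<longleftrightarrow> matched x y"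
  unfolding two_completions.matched_def[OF swap] matched_def by blast

definition completion_iso :: "'b \<Rightarrow> 'c" where
  "completion_iso = restrict (\<lambda>x. THE y. matched x y) (carrier L)"

lemma completion_iso_eq: "matched x y \<Longrightarrow> completion_iso x = y"
  unfolding completion_iso_def by (auto simp: matched_closed intro: the_equality matched_unique)

lemma matched_completion_iso: "x \<in> carrier L \<Longrightarrow> matched x (completion_iso x)"
  using matched_exists completion_iso_eq by auto

lemma completion_iso_is_iso: "reduced_sigma_algebra_iso L \<mu> K \<nu> completion_iso"
  unfolding reduced_sigma_algebra_iso_def sigma_morphism_def
proof (intro conjI ballI allI impI)
  interpret swap: two_completions B K \<nu> L \<mu> \<gamma> \<beta> by (rule swap)
  note eq = completion_iso_eq and m = matched_completion_iso
  have join: "completion_iso (x \<squnion>\<^bsub>L\<^esub> x') = completion_iso x \<squnion>\<^bsub>K\<^esub> completion_iso x'" if "x \<in> carrier L" "x' \<in> carrier L" for x x'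
    by (intro eq matched_join m that)
  show "boolean_morphism L K completion_iso"
    unfolding boolean_morphism_def
  proof (intro conjI ballI impI)
    show "completion_iso \<in> carrier L \<rightarrow> carrier K" using m by (auto simp: matched_def)
    fix x y assume xy: "x \<in> carrier L" "y \<in> carrier L"
    show "completion_iso (x \<squnion>\<^bsub>L\<^esub> y) = completion_iso x \<squnion>\<^bsub>K\<^esub> completion_iso y" by (rule join[OF xy])
    assume "x \<sqsubseteq>\<^bsub>L\<^esub> y"
    then have "completion_iso x \<squnion>\<^bsub>K\<^esub> completion_iso y = completion_iso y"
      using xy join[OF xy] L.le_iff_meet by simp
    then show "completion_iso x \<sqsubseteq>\<^bsub>K\<^esub> completion_iso y"
      using m xy K.le_iff_meet[of "completion_iso x" "completion_iso y"] by (auto simp: matched_def)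
  qed (auto intro!: eq matched_bottom matched_top matched_compl m)
  show "bij_betw completion_iso (carrier L) (carrier K)"
  proof (rule bij_betw_imageI)
    show "inj_on completion_iso (carrier L)"
      using m swap.matched_unique swap_matched by (metis inj_onI)
    have "\<exists>x\<in>carrier L. completion_iso x = y" if "y \<in> carrier K" for y
      using swap.matched_exists[OF that] swap_matched eq matched_closed by metis
    moreover have "completion_iso x \<in> carrier K" if "x \<in> carrier L" for x
      using m[OF that] by (rule matched_closed)
    ultimately show "completion_iso ` carrier L = carrier K" by auto
  qed
  show "\<nu> (completion_iso x) = \<mu> x" if "x \<in> carrier L" for x
    using matched_measure[OF m[OF that]] by simp
  fix A assume A: "A \<subseteq> carrier L \<and> countable A"
  show "completion_iso (\<Squnion>\<^bsub>L\<^esub> A) = \<Squnion>\<^bsub>K\<^esub> (completion_iso ` A)"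
  proof (cases "A = {}")
    case True
    then show ?thesis using eq[OF matched_bottom] L.countable_sup_empty K.countable_sup_empty by simp
  next
    case False
    with A obtain x :: "nat \<Rightarrow> 'b" where x: "A = range x" using range_from_nat_into[of A] by metis
    then show ?thesis using A by (auto intro!: eq matched_sup m simp: image_image subset_iff)
  qed
qed

end

text \<open>The equalizer of two morphisms is a sigma-subalgebra.\<close>

lemma sigma_morphism_eq_on_generated:
  assumes "abstract_sigma_algebra L"
    and f: "sigma_morphism L K f" and g: "sigma_morphism L K g"
    and gen: "sigma_generated_by L G" and G: "G \<subseteq> carrier L" and eq: "\<And>x. x \<in> G \<Longrightarrow> f x = g x"
    and x: "x \<in> carrier L"
  shows "f x = g x"
proof -
  interpret abstract_sigma_algebra L by fact
  interpret boolean_gorder L by unfold_locales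
  let ?S = "{x \<in> carrier L. f x = g x}"
  have "sigma_subalgebra ?S L"
    unfolding sigma_subalgebra_def
  proof (intro conjI ballI allI impI)
    fix A assume A: "A \<subseteq> ?S \<and> countable A"
    then have "f (\<Squnion>\<^bsub>L\<^esub> A) = \<Squnion>\<^bsub>K\<^esub> (f ` A)" "g (\<Squnion>\<^bsub>L\<^esub> A) = \<Squnion>\<^bsub>K\<^esub> (g ` A)" "f ` A = g ` A"
      using f g by (auto simp: sigma_morphism_def subset_iff)
    moreover have "A \<subseteq> carrier L" using A by auto
    ultimately show "\<Squnion>\<^bsub>L\<^esub> A \<in> ?S" using A by simp
  qed (use f g in \<open>auto simp: sigma_morphism_def boolean_morphism_def\<close>)
  then show ?thesis using gen G eq x by (auto simp: sigma_generated_by_def)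
qed

text \<open>The isomorphism is \<open>completion_iso\<close>; it is the only one over \<open>B\<close>, since the image of \<open>B\<close> generates \<open>L\<close>.
  Extensionality makes it unique as a total function.\<close>

theorem associated_reduced_algebra_unique:
  assumes B: "boolean_lattice B" and fin: "\<mu>\<^sub>0 \<top>\<^bsub>B\<^esub> \<noteq> \<infinity>"
    and L: "associated_reduced_algebra B \<mu>\<^sub>0 L \<mu> \<beta>" and K: "associated_reduced_algebra B \<mu>\<^sub>0 K \<nu> \<gamma>"
  shows "\<exists>!\<phi>. \<phi> \<in> extensional (carrier L) \<and> reduced_sigma_algebra_iso L \<mu> K \<nu> \<phi> \<and>
           (\<forall>b\<in>carrier B. \<phi> (\<beta> b) = \<gamma> b)"
proof -
  interpret B: boolean_gorder B using B by (simp add: boolean_gorder_def)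
  interpret L: reduced_sigma_algebra L \<mu> using L by (simp add: associated_reduced_algebra_def)
  interpret K: reduced_sigma_algebra K \<nu> using K by (simp add: associated_reduced_algebra_def)
  have top_and_image: "\<beta> \<top>\<^bsub>B\<^esub> = \<top>\<^bsub>L\<^esub>" "\<beta> ` carrier B \<subseteq> carrier L"
    using L by (auto simp: associated_reduced_algebra_def boolean_morphism_def)
  interpret two_completions B L \<mu> K \<nu> \<beta> \<gamma>
    using L K fin top_and_image by unfold_locales (auto simp: associated_reduced_algebra_def simp flip: top_and_image(1))
  show ?thesis
  proof (rule ex1I)
    show "completion_iso \<in> extensional (carrier L) \<and> reduced_sigma_algebra_iso L \<mu> K \<nu> completion_iso \<and>
           (\<forall>b\<in>carrier B. completion_iso (\<beta> b) = \<gamma> b)"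
      using completion_iso_is_iso completion_iso_eq[OF matched_image] by (auto simp: completion_iso_def)
    fix \<phi> assume \<phi>: "\<phi> \<in> extensional (carrier L) \<and> reduced_sigma_algebra_iso L \<mu> K \<nu> \<phi> \<and>
           (\<forall>b\<in>carrier B. \<phi> (\<beta> b) = \<gamma> b)"
    have "\<phi> x = completion_iso x" if "x \<in> carrier L" for x
    proof (rule sigma_morphism_eq_on_generated[OF _ _ _ gen_\<beta> top_and_image(2) _ that])
      show "abstract_sigma_algebra L" by unfold_locales
      show "sigma_morphism L K \<phi>" "sigma_morphism L K completion_iso"
        using \<phi> completion_iso_is_iso by (auto simp: reduced_sigma_algebra_iso_def)
    qed (use \<phi> completion_iso_eq[OF matched_image] in auto)
    then show "\<phi> = completion_iso"
      using \<phi> by (intro extensionalityI[of _ "carrier L"]) (auto simp: completion_iso_def)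
  qed
qed

section \<open>The quotient of a measure space by its null sets\<close>

lemma null_rel_iff:
  "(A, B) \<in> null_rel M \<longleftrightarrow> A \<in> sets M \<and> B \<in> sets M \<and> (AE x in M. x \<in> A \<longleftrightarrow> x \<in> B)"
proof -
  have "sym_diff A B \<in> null_sets M \<longleftrightarrow> (AE x in M. x \<in> A \<longleftrightarrow> x \<in> B)"
    if "A \<in> sets M" "B \<in> sets M"
    using that by (subst AE_iff_null_sets) (auto intro!: AE_cong)
  then show ?thesis by (auto simp: null_rel_def)
qed

lemma equiv_null_rel: "equiv (sets M) (null_rel M)"
  by (rule equivI) (auto simp: refl_on_def sym_def trans_def null_rel_iff)

lemma carrier_null_quotient: "carrier (null_quotient M) = null_class M ` sets M"
  by (auto simp: null_quotient_def null_class_def quotient_def)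

lemma null_class_in_carrier [simp]: "A \<in> sets M \<Longrightarrow> null_class M A \<in> carrier (null_quotient M)"
  by (simp add: carrier_null_quotient)

lemma in_null_class_iff:
  "B \<in> null_class M A \<longleftrightarrow> A \<in> sets M \<and> B \<in> sets M \<and> (AE x in M. x \<in> A \<longleftrightarrow> x \<in> B)"
  by (simp add: null_class_def null_rel_iff)

lemma null_class_eq_iff:
  "\<lbrakk>A \<in> sets M; B \<in> sets M\<rbrakk> \<Longrightarrow> null_class M A = null_class M B \<longleftrightarrow> (AE x in M. x \<in> A \<longleftrightarrow> x \<in> B)"
  using eq_equiv_class_iff[OF equiv_null_rel, of A M B] by (simp add: null_class_def null_rel_iff)

text \<open>The order of the quotient asks for nested representatives. An almost sure inclusion provides them:
  \<open>A\<close> and \<open>A \<inter> B\<close> have the same class.\<close>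

lemma null_class_le_iff:
  assumes "A \<in> sets M" "B \<in> sets M"
  shows "null_class M A \<sqsubseteq>\<^bsub>null_quotient M\<^esub> null_class M B \<longleftrightarrow> (AE x in M. x \<in> A \<longrightarrow> x \<in> B)"
proof
  assume "null_class M A \<sqsubseteq>\<^bsub>null_quotient M\<^esub> null_class M B"
  then obtain A' B' where "A' \<in> null_class M A" "B' \<in> null_class M B" "A' \<subseteq> B'"
    by (auto simp: null_quotient_def)
  then show "AE x in M. x \<in> A \<longrightarrow> x \<in> B"
    by (auto simp: in_null_class_iff)
next
  assume "AE x in M. x \<in> A \<longrightarrow> x \<in> B"
  then have "A \<inter> B \<in> null_class M A" "B \<in> null_class M B" "A \<inter> B \<subseteq> B"
    using assms by (auto simp: in_null_class_iff)
  then show "null_class M A \<sqsubseteq>\<^bsub>null_quotient M\<^esub> null_class M B"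
    unfolding null_quotient_def by (simp only: gorder.simps) blast
qed

lemma null_quotient_partial_order: "partial_order (null_quotient M)"
proof unfold_locales
  show "(.=\<^bsub>null_quotient M\<^esub>) = (=)" by (simp add: null_quotient_def)
  fix P Q assume le: "P \<sqsubseteq>\<^bsub>null_quotient M\<^esub> Q" "Q \<sqsubseteq>\<^bsub>null_quotient M\<^esub> P"
    and "P \<in> carrier (null_quotient M)" "Q \<in> carrier (null_quotient M)"
  then obtain A B where AB: "A \<in> sets M" "B \<in> sets M" "P = null_class M A" "Q = null_class M B"
    by (auto simp: carrier_null_quotient)
  then have "AE x in M. x \<in> A \<longrightarrow> x \<in> B" "AE x in M. x \<in> B \<longrightarrow> x \<in> A"
    using le by (simp_all only: null_class_le_iff)
  then have "AE x in M. x \<in> A \<longleftrightarrow> x \<in> B" by eventually_elim blast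
  then have "P = Q" using AB by (simp add: null_class_eq_iff)
  then show "P .=\<^bsub>null_quotient M\<^esub> Q" by (simp add: null_quotient_def)
next
  fix P Q R assume "P \<sqsubseteq>\<^bsub>null_quotient M\<^esub> Q" "Q \<sqsubseteq>\<^bsub>null_quotient M\<^esub> R"
    "P \<in> carrier (null_quotient M)" "Q \<in> carrier (null_quotient M)" "R \<in> carrier (null_quotient M)"
  then show "P \<sqsubseteq>\<^bsub>null_quotient M\<^esub> R"
    by (auto simp: carrier_null_quotient null_class_le_iff)
next
  fix P assume "P \<in> carrier (null_quotient M)"
  then show "P \<sqsubseteq>\<^bsub>null_quotient M\<^esub> P"
    by (auto simp: carrier_null_quotient null_class_le_iff)
qed (simp_all add: null_quotient_def)

lemma null_class_Union_lub:
  assumes "\<A> \<subseteq> sets M" "countable \<A>"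
  shows "is_lub (null_quotient M) (null_class M (\<Union>\<A>)) (null_class M ` \<A>)"
proof -
  have [measurable]: "\<Union>\<A> \<in> sets M" using assms by (intro sets.countable_Union)
  have above: "null_class M A \<sqsubseteq>\<^bsub>null_quotient M\<^esub> null_class M (\<Union>\<A>)" if "A \<in> \<A>" for A
    using that assms by (subst null_class_le_iff) auto
  have below: "null_class M (\<Union>\<A>) \<sqsubseteq>\<^bsub>null_quotient M\<^esub> null_class M B"
    if B: "B \<in> sets M" and le: "\<And>A. A \<in> \<A> \<Longrightarrow> null_class M A \<sqsubseteq>\<^bsub>null_quotient M\<^esub> null_class M B" for B
  proof -
    have "AE x in M. x \<in> A \<longrightarrow> x \<in> B" if "A \<in> \<A>" for A
      using le[OF that] that assms B by (subst (asm) null_class_le_iff) auto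
    then have "AE x in M. \<forall>A\<in>\<A>. x \<in> A \<longrightarrow> x \<in> B"
      using assms by (subst AE_ball_countable) auto
    then show ?thesis using B by (subst null_class_le_iff) auto
  qed
  show ?thesis
  proof (rule least_UpperI)
    fix Q assume Q: "Q \<in> Upper (null_quotient M) (null_class M ` \<A>)"
    then obtain B where B: "B \<in> sets M" "Q = null_class M B"
      by (auto simp: Upper_def carrier_null_quotient)
    have "null_class M A \<sqsubseteq>\<^bsub>null_quotient M\<^esub> null_class M B" if "A \<in> \<A>" for A
      using Q that assms(1) B(2) by (auto simp: Upper_def)
    then show "null_class M (\<Union>\<A>) \<sqsubseteq>\<^bsub>null_quotient M\<^esub> Q"
      unfolding B(2) by (rule below[OF B(1)])
  qed (use assms above in auto)
qed

lemma null_class_Int_glb: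
  assumes [measurable]: "A \<in> sets M" "B \<in> sets M"
  shows "is_glb (null_quotient M) (null_class M (A \<inter> B)) {null_class M A, null_class M B}"
proof (rule greatest_LowerI)
  fix Q assume Q: "Q \<in> Lower (null_quotient M) {null_class M A, null_class M B}"
  then obtain C where C: "C \<in> sets M" "Q = null_class M C"
    by (auto simp: Lower_def carrier_null_quotient)
  then have "AE x in M. x \<in> C \<longrightarrow> x \<in> A" "AE x in M. x \<in> C \<longrightarrow> x \<in> B"
    using Q assms by (simp_all add: Lower_def null_class_le_iff)
  then have "AE x in M. x \<in> C \<longrightarrow> x \<in> A \<inter> B" by eventually_elim blast
  then show "Q \<sqsubseteq>\<^bsub>null_quotient M\<^esub> null_class M (A \<inter> B)"
    using C assms by (simp only: null_class_le_iff sets.Int)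
next
  fix P assume "P \<in> {null_class M A, null_class M B}"
  then obtain C where C: "C \<in> sets M" "P = null_class M C" "A \<inter> B \<subseteq> C"
    using assms by blast
  then show "null_class M (A \<inter> B) \<sqsubseteq>\<^bsub>null_quotient M\<^esub> P"
    by (simp add: null_class_le_iff subset_iff)
qed (use assms in auto)

lemma null_class_empty_least: "least (null_quotient M) (null_class M {}) (carrier (null_quotient M))"
  by (auto simp: least_def carrier_null_quotient null_class_le_iff)

lemma null_class_space_greatest:
  "greatest (null_quotient M) (null_class M (space M)) (carrier (null_quotient M))"
  by (auto simp: greatest_def carrier_null_quotient null_class_le_iff)

lemma null_quotient_bounded_lattice: "bounded_lattice (null_quotient M)"
proof -
  interpret partial_order "null_quotient M" by (rule null_quotient_partial_order)
  show ?thesis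
  proof unfold_locales
    fix P Q assume "P \<in> carrier (null_quotient M)" "Q \<in> carrier (null_quotient M)"
    then obtain A B where "A \<in> sets M" "B \<in> sets M" "P = null_class M A" "Q = null_class M B"
      by (auto simp: carrier_null_quotient)
    then show "\<exists>s. is_lub (null_quotient M) s {P, Q}" "\<exists>s. is_glb (null_quotient M) s {P, Q}"
      using null_class_Union_lub[of "{A, B}" M] null_class_Int_glb[of A M B] by auto
  qed (use null_class_empty_least null_class_space_greatest in blast)+
qed

lemma null_class_bottom: "\<bottom>\<^bsub>null_quotient M\<^esub> = null_class M {}"
proof -
  interpret bounded_lattice "null_quotient M" by (rule null_quotient_bounded_lattice)
  show ?thesis using least_unique[OF bottom_least null_class_empty_least] .
qed

lemma null_class_top: "\<top>\<^bsub>null_quotient M\<^esub> = null_class M (space M)"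
proof -
  interpret bounded_lattice "null_quotient M" by (rule null_quotient_bounded_lattice)
  show ?thesis using greatest_unique[OF top_greatest null_class_space_greatest] .
qed

lemma null_class_join:
  assumes "A \<in> sets M" "B \<in> sets M"
  shows "null_class M A \<squnion>\<^bsub>null_quotient M\<^esub> null_class M B = null_class M (A \<union> B)"
proof -
  interpret bounded_lattice "null_quotient M" by (rule null_quotient_bounded_lattice)
  show ?thesis
    using least_unique[OF sup_of_two_least null_class_Union_lub[of "{A, B}" M, simplified]] assms
    by (simp add: Lattice.join_def)
qed

lemma null_class_meet:
  assumes "A \<in> sets M" "B \<in> sets M"
  shows "null_class M A \<sqinter>\<^bsub>null_quotient M\<^esub> null_class M B = null_class M (A \<inter> B)"
proof -
  interpret bounded_lattice "null_quotient M" by (rule null_quotient_bounded_lattice)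
  show ?thesis
    using greatest_unique[OF inf_of_two_greatest null_class_Int_glb] assms
    by (simp add: meet_def)
qed

lemma null_quotient_sigma_algebra: "abstract_sigma_algebra (null_quotient M)"
proof -
  interpret bounded_lattice "null_quotient M" by (rule null_quotient_bounded_lattice)
  show ?thesis
  proof unfold_locales
    fix P Q R
    assume "P \<in> carrier (null_quotient M)" "Q \<in> carrier (null_quotient M)" "R \<in> carrier (null_quotient M)"
    then show "P \<sqinter>\<^bsub>null_quotient M\<^esub> (Q \<squnion>\<^bsub>null_quotient M\<^esub> R) =
        (P \<sqinter>\<^bsub>null_quotient M\<^esub> Q) \<squnion>\<^bsub>null_quotient M\<^esub> (P \<sqinter>\<^bsub>null_quotient M\<^esub> R)"
      by (auto simp: carrier_null_quotient null_class_join null_class_meet Int_Un_distrib)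
  next
    fix P assume "P \<in> carrier (null_quotient M)"
    then obtain A where A: "A \<in> sets M" "P = null_class M A" by (auto simp: carrier_null_quotient)
    then have "A \<union> (space M - A) = space M" using sets.sets_into_space by blast
    then show "\<exists>Q\<in>carrier (null_quotient M). P \<squnion>\<^bsub>null_quotient M\<^esub> Q = \<top>\<^bsub>null_quotient M\<^esub> \<and>
        P \<sqinter>\<^bsub>null_quotient M\<^esub> Q = \<bottom>\<^bsub>null_quotient M\<^esub>"
      using A by (intro bexI[of _ "null_class M (space M - A)"])
        (auto simp: null_class_join null_class_meet null_class_top null_class_bottom)
  next
    fix \<P> assume "\<P> \<subseteq> carrier (null_quotient M)" "countable \<P>"
    then obtain \<A> where "countable \<A>" "\<A> \<subseteq> sets M" "\<P> = null_class M ` \<A>"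
      using countable_subset_image[of \<P> "null_class M" "sets M"] by (auto simp: carrier_null_quotient)
    then show "\<exists>s. is_lub (null_quotient M) s \<P>"
      using null_class_Union_lub[of \<A> M] by auto
  qed
qed

lemma null_class_Sup:
  assumes "\<A> \<subseteq> sets M" "countable \<A>"
  shows "\<Squnion>\<^bsub>null_quotient M\<^esub> (null_class M ` \<A>) = null_class M (\<Union>\<A>)"
proof -
  interpret abstract_sigma_algebra "null_quotient M" by (rule null_quotient_sigma_algebra)
  show ?thesis
    by (rule countable_sup_eqI[OF _ _ null_class_Union_lub[OF assms]]) (use assms in auto)
qed

lemma null_class_compl:
  assumes "A \<in> sets M"
  shows "lattice_compl (null_quotient M) (null_class M A) = null_class M (space M - A)"
proof -
  interpret abstract_sigma_algebra "null_quotient M" by (rule null_quotient_sigma_algebra)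
  interpret boolean_gorder "null_quotient M" by unfold_locales
  have "A \<union> (space M - A) = space M" using assms sets.sets_into_space by blast
  then show ?thesis
    using assms
    by (intro lattice_compl_eqI) (auto simp: null_class_join null_class_meet null_class_top null_class_bottom)
qed

lemma null_quotient_measure_class:
  assumes "A \<in> sets M"
  shows "null_quotient_measure M (null_class M A) = emeasure M A"
proof -
  have "emeasure M ` null_class M A = {emeasure M A}"
    using assms by (auto simp: in_null_class_iff intro!: emeasure_eq_AE image_eqI[of _ _ A])
  then show ?thesis by (simp add: null_quotient_measure_def)
qed

text \<open>Disjoint classes have representatives that overlap in null sets only; removing these countably many
  overlaps makes the sets disjoint.\<close>

lemma emeasure_UN_AE_disjoint:
  fixes A :: "nat \<Rightarrow> 'a set"
  assumes A [measurable]: "\<And>i. A i \<in> sets M"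
    and disj: "\<And>i j. i \<noteq> j \<Longrightarrow> AE x in M. x \<notin> A i \<inter> A j"
  shows "emeasure M (\<Union>i. A i) = (\<Sum>i. emeasure M (A i))"
proof -
  define D where "D i = A i - (\<Union>j\<in>-{i}. A j)" for i
  have [measurable]: "D i \<in> sets M" for i
    unfolding D_def by (intro sets.Diff sets.countable_UN'') auto
  have "AE x in M. \<forall>i j. i \<noteq> j \<longrightarrow> x \<notin> A i \<inter> A j"
    using disj by (simp add: AE_all_countable)
  then have "AE x in M. \<forall>i. x \<in> D i \<longleftrightarrow> x \<in> A i"
    by eventually_elim (auto simp: D_def)
  then have AE: "AE x in M. x \<in> D i \<longleftrightarrow> x \<in> A i" "AE x in M. x \<in> (\<Union>i. D i) \<longleftrightarrow> x \<in> (\<Union>i. A i)" for i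
    by auto
  have "emeasure M (\<Union>i. A i) = emeasure M (\<Union>i. D i)"
    using AE(2) by (intro emeasure_eq_AE) auto
  also have "\<dots> = (\<Sum>i. emeasure M (D i))"
    by (intro suminf_emeasure[symmetric]) (auto simp: disjoint_family_on_def D_def)
  also have "\<dots> = (\<Sum>i. emeasure M (A i))"
    using AE(1) by (intro suminf_cong emeasure_eq_AE) auto
  finally show ?thesis .
qed

theorem null_quotient_reduced: "reduced_sigma_algebra (null_quotient M) (null_quotient_measure M)"
proof -
  interpret abstract_sigma_algebra "null_quotient M" by (rule null_quotient_sigma_algebra)
  show ?thesis
  proof unfold_locales
    show "null_quotient_measure M \<bottom>\<^bsub>null_quotient M\<^esub> = 0"
      by (simp add: null_class_bottom null_quotient_measure_class)
  next
    fix a :: "nat \<Rightarrow> _" assume "a \<in> UNIV \<rightarrow> carrier (null_quotient M)"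
      and disj: "\<And>i j. i \<noteq> j \<Longrightarrow> a i \<sqinter>\<^bsub>null_quotient M\<^esub> a j = \<bottom>\<^bsub>null_quotient M\<^esub>"
    then have "\<forall>i. \<exists>A\<in>sets M. a i = null_class M A" by (auto simp: carrier_null_quotient Pi_iff image_iff)
    then obtain A where A: "\<And>i. A i \<in> sets M" and a: "a = (\<lambda>i. null_class M (A i))" by metis
    have "AE x in M. x \<notin> A i \<inter> A j" if "i \<noteq> j" for i j
    proof -
      have "null_class M (A i \<inter> A j) = null_class M {}"
        using disj[OF that] A by (simp add: a null_class_meet null_class_bottom)
      then show ?thesis using A by (subst (asm) null_class_eq_iff) auto
    qed
    then have "emeasure M (\<Union>i. A i) = (\<Sum>i. emeasure M (A i))"
      by (intro emeasure_UN_AE_disjoint A)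
    moreover have "\<Squnion>\<^bsub>null_quotient M\<^esub> (range a) = null_class M (\<Union>i. A i)"
      using null_class_Sup[of "range A" M] A by (auto simp: a image_image)
    moreover have "(\<Union>i. A i) \<in> sets M" using A by auto
    ultimately show "null_quotient_measure M (\<Squnion>\<^bsub>null_quotient M\<^esub> (range a)) = (\<Sum>i. null_quotient_measure M (a i))"
      using A by (simp add: null_quotient_measure_class a)
  next
    fix P assume "P \<in> carrier (null_quotient M)" and 0: "null_quotient_measure M P = 0"
    then obtain A where A: "A \<in> sets M" "P = null_class M A" by (auto simp: carrier_null_quotient)
    with 0 have "A \<in> null_sets M" by (auto simp: null_quotient_measure_class)
    then show "P = \<bottom>\<^bsub>null_quotient M\<^esub>"
      using A AE_not_in[of A M] by (auto simp: null_class_bottom null_class_eq_iff)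
  qed
qed

text \<open>The measurable sets whose class lies in a given sigma-subalgebra form a sigma-algebra of sets.\<close>

lemma null_quotient_generated:
  assumes G: "sets M = sigma_sets (space M) G"
  shows "sigma_generated_by (null_quotient M) (null_class M ` G)"
  unfolding sigma_generated_by_def
proof (intro allI impI)
  fix S assume S: "sigma_subalgebra S (null_quotient M) \<and> null_class M ` G \<subseteq> S"
  have "A \<in> sets M \<and> null_class M A \<in> S" if "A \<in> sigma_sets (space M) G" for A
    using that
  proof induction
    case (Basic A)
    then show ?case using S G by auto
  next
    case Empty
    then show ?case using S by (auto simp: sigma_subalgebra_def null_class_bottom)
  next
    case (Compl A)
    then have "lattice_compl (null_quotient M) (null_class M A) \<in> S" using S by (auto simp: sigma_subalgebra_def)
    then show ?case using Compl by (auto simp: null_class_compl)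
  next
    case (Union A)
    then have "\<Squnion>\<^bsub>null_quotient M\<^esub> (null_class M ` range A) \<in> S"
      using S by (auto simp: sigma_subalgebra_def image_subset_iff)
    moreover have "range A \<subseteq> sets M" using Union by auto
    ultimately show ?case using null_class_Sup[of "range A" M] by auto
  qed
  then show "S = carrier (null_quotient M)"
    using S G by (auto simp: carrier_null_quotient sigma_subalgebra_def)
qed

section \<open>Finite measures and Gaussian laws on finite powers of the real line\<close>

text \<open>The measure \<open>w \<cdot> N\<close>, scaled to total mass one and pushed forward along \<open>X\<close>, is a probability measure on
  the line whose characteristic function is known; Levy's uniqueness theorem applies to it.\<close>

lemma weighted_law_eqI:
  fixes X w :: "'a \<Rightarrow> real"
  assumes N: "finite_measure N" and N': "finite_measure N'" and sets: "sets N' = sets N"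
    and X: "X \<in> borel_measurable N" and w: "w \<in> borel_measurable N"
    and bounds: "\<And>x. 0 \<le> w x" "\<And>x. w x \<le> C"
    and eq: "\<And>s. (CLINT x|N. of_real (w x) * iexp (s * X x)) = (CLINT x|N'. of_real (w x) * iexp (s * X x))"
    and A: "A \<in> sets borel"
  shows "(LINT x|N. w x * indicator A (X x)) = (LINT x|N'. w x * indicator A (X x))"
proof -
  define c where "c = (LINT x|N. w x)"
  \<comment> \<open>At \<open>s = 0\<close> the hypothesis says that the two weighted measures have the same total mass \<open>c\<close>.\<close>
  have "of_real (LINT x|N. w x) = (of_real (LINT x|N'. w x) :: complex)"
    using eq[of 0] by simp
  then have c': "c = (LINT x|N'. w x)"
    unfolding c_def by (simp only: of_real_eq_iff)
  have N_cases: "finite_measure Q \<and> X \<in> borel_measurable Q \<and> w \<in> borel_measurable Q \<and> (LINT x|Q. w x) = c"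
    if "Q = N \<or> Q = N'" for Q
    using that N N' X w c' by (auto simp: c_def measurable_cong_sets[OF sets refl])
  have int: "integrable Q w" if "Q = N \<or> Q = N'" for Q
    using N_cases[OF that] bounds by (intro finite_measure.integrable_const_bound[where B = C]) auto
  show ?thesis
  proof (cases "c = 0")
    case True
    have "(LINT x|Q. w x * indicator A (X x)) = 0" if "Q = N \<or> Q = N'" for Q
    proof -
      have "AE x in Q. w x = 0"
        using integral_nonneg_eq_0_iff_AE[OF int[OF that]] N_cases[OF that] bounds True by auto
      then show ?thesis by (intro integral_eq_zero_AE) auto
    qed
    then show ?thesis by simp
  next
    case False
    moreover have "0 \<le> c" unfolding c_def using bounds by (intro integral_nonneg_AE) auto
    ultimately have c: "c > 0" by simp
    define D where "D Q = density Q (\<lambda>x. ennreal (w x / c))" for Q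
    have D: "real_distribution (distr (D Q) borel X) \<and>
        char (distr (D Q) borel X) s = (CLINT x|Q. of_real (w x) * iexp (s * X x)) / of_real c \<and>
        measure (distr (D Q) borel X) A = (LINT x|Q. w x * indicator A (X x)) / c"
      if Q: "Q = N \<or> Q = N'" for Q s
    proof (intro conjI)
      have [measurable]: "X \<in> borel_measurable Q" "w \<in> borel_measurable Q" using N_cases[OF Q] by auto
      note [measurable] = A
      have XD [measurable]: "X \<in> borel_measurable (D Q)" by (simp add: D_def)
      have "emeasure (D Q) (space (D Q)) = (\<integral>\<^sup>+x. ennreal (w x / c) \<partial>Q)"
        by (simp add: D_def emeasure_density cong: nn_integral_cong)
      also have "\<dots> = ennreal (LINT x|Q. w x / c)"
        using int[OF Q] bounds c by (intro nn_integral_eq_integral) auto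
      also have "\<dots> = 1" using N_cases[OF Q] c by simp
      finally interpret D: prob_space "D Q" by (rule prob_spaceI)
      show "real_distribution (distr (D Q) borel X)" by (rule D.real_distribution_distr) measurable
      have "char (distr (D Q) borel X) s = (CLINT x|D Q. iexp (s * X x))"
        unfolding char_def by (rule integral_distr) measurable
      also have "\<dots> = (CLINT x|Q. (w x / c) *\<^sub>R iexp (s * X x))"
        unfolding D_def using bounds c by (intro integral_density) auto
      also have "\<dots> = (CLINT x|Q. (of_real (w x) * iexp (s * X x)) / of_real c)"
        by (intro Bochner_Integration.integral_cong) (auto simp: scaleR_conv_of_real)
      also have "\<dots> = (CLINT x|Q. of_real (w x) * iexp (s * X x)) / of_real c"
        by (rule integral_divide_zero)
      finally show "char (distr (D Q) borel X) s = (CLINT x|Q. of_real (w x) * iexp (s * X x)) / of_real c" .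
      have "measure (distr (D Q) borel X) A = (LINT x|distr (D Q) borel X. indicator A x)"
        by simp
      also have "\<dots> = (LINT x|D Q. indicator A (X x))"
        by (rule integral_distr) measurable
      also have "\<dots> = (LINT x|Q. (w x / c) *\<^sub>R indicator A (X x))"
        unfolding D_def using bounds c by (intro integral_density) auto
      also have "\<dots> = (LINT x|Q. w x * indicator A (X x)) / c"
        by (simp flip: integral_divide_zero)
      finally show "measure (distr (D Q) borel X) A = (LINT x|Q. w x * indicator A (X x)) / c" .
    qed
    have "distr (D N) borel X = distr (D N') borel X"
      using D eq by (intro Levy_uniqueness ext) auto
    then show ?thesis using D[of N] D[of N'] c by simp
  qed
qed

text \<open>A complex weight \<open>Y\<close> of modulus at most one is handled through the nonnegative weights \<open>1 + Re Y\<close> and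
  \<open>1 + Im Y\<close>. The conjugate \<open>cnj Y\<close> that enters with the real part is covered by the same hypothesis at
  frequency \<open>-s\<close>, and the summand 1 by the hypothesis on the law of \<open>X\<close>.\<close>

lemma complex_weighted_law_eqI:
  fixes X :: "'a \<Rightarrow> real" and Y :: "'a \<Rightarrow> complex"
  assumes N: "finite_measure N" and N': "finite_measure N'" and sets: "sets N' = sets N"
    and X: "X \<in> borel_measurable N" and Y: "Y \<in> borel_measurable N" and bound: "\<And>x. norm (Y x) \<le> 1"
    and law: "\<And>s. (CLINT x|N. iexp (s * X x)) = (CLINT x|N'. iexp (s * X x))"
    and eq: "\<And>s. (CLINT x|N. Y x * iexp (s * X x)) = (CLINT x|N'. Y x * iexp (s * X x))"
    and A: "A \<in> sets borel"
  shows "(CLINT x|N. indicator A (X x) * Y x) = (CLINT x|N'. indicator A (X x) * Y x)"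
proof -
  note [measurable] = X Y A
  have [measurable]: "X \<in> borel_measurable N'" "Y \<in> borel_measurable N'"
    using X Y by (simp_all add: measurable_cong_sets[OF sets refl])
  have int: "integrable Q f"
    if Q: "Q = N \<or> Q = N'" and f: "f \<in> borel_measurable N" "\<And>x. norm (f x) \<le> 1" for Q and f :: "'a \<Rightarrow> complex"
    using that N N' sets by (intro finite_measure.integrable_const_bound[where B = 1]) (auto simp: measurable_cong_sets[OF sets refl])
  have intr: "integrable Q f"
    if Q: "Q = N \<or> Q = N'" and f: "f \<in> borel_measurable N" "\<And>x. norm (f x) \<le> 1" for Q and f :: "'a \<Rightarrow> real"
    using that N N' sets by (intro finite_measure.integrable_const_bound[where B = 1]) (auto simp: measurable_cong_sets[OF sets refl])
  \<comment> \<open>The constant weight 1.\<close>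
  have ind: "(LINT x|N. indicator A (X x)) = (LINT x|N'. indicator A (X x) :: real)"
    using weighted_law_eqI[OF N N' sets X, of "\<lambda>_. 1" 1 A] law A by simp
  have Re: "(LINT x|N. indicator A (X x) * Re (Z x)) = (LINT x|N'. indicator A (X x) * Re (Z x))"
    if Z [measurable]: "Z \<in> borel_measurable N" and Zb: "\<And>x. norm (Z x) \<le> 1"
      and Zeq: "\<And>s. (CLINT x|N. Z x * iexp (s * X x)) = (CLINT x|N'. Z x * iexp (s * X x))" for Z
  proof -
    have R: "\<bar>Re (Z x)\<bar> \<le> 1" for x using abs_Re_le_cmod[of "Z x"] Zb[of x] by linarith
    have expand: "(CLINT x|Q. of_real (1 + Re (Z x)) * iexp (s * X x)) =
        (CLINT x|Q. iexp (s * X x)) + (CLINT x|Q. Z x * iexp (s * X x)) / 2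
          + cnj (CLINT x|Q. Z x * iexp (- s * X x)) / 2" if Q: "Q = N \<or> Q = N'" for Q s
    proof -
      have i1: "integrable Q (\<lambda>x. iexp (s * X x))" by (rule int[OF Q]) auto
      have i2: "integrable Q (\<lambda>x. Z x * iexp (s * X x) / 2)"
        using Zb by (intro integrable_divide int[OF Q]) (auto simp: norm_mult)
      have i3: "integrable Q (\<lambda>x. cnj (Z x * iexp (- s * X x)) / 2)"
        using Zb by (intro integrable_divide integrable_cnj int[OF Q]) (auto simp: norm_mult)
      have "of_real (1 + Re (Z x)) * iexp (s * X x) =
          iexp (s * X x) + Z x * iexp (s * X x) / 2 + cnj (Z x * iexp (- s * X x)) / 2" for x
      proof -
        have "cnj (iexp (- s * X x)) = iexp (s * X x)" by (simp add: exp_cnj)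
        moreover have "of_real (Re (Z x)) = (Z x + cnj (Z x)) / 2" by (simp add: complex_add_cnj)
        ultimately show ?thesis
          by (simp only: complex_cnj_mult of_real_add of_real_1 distrib_right add_divide_distrib
              times_divide_eq_left mult_1 add.assoc)
      qed
      then have "(CLINT x|Q. of_real (1 + Re (Z x)) * iexp (s * X x)) =
          (CLINT x|Q. iexp (s * X x) + Z x * iexp (s * X x) / 2 + cnj (Z x * iexp (- s * X x)) / 2)"
        by simp
      also have "\<dots> = (CLINT x|Q. iexp (s * X x)) + (CLINT x|Q. Z x * iexp (s * X x) / 2)
          + (CLINT x|Q. cnj (Z x * iexp (- s * X x)) / 2)"
        using i1 i2 i3 by (simp only: Bochner_Integration.integral_add Bochner_Integration.integrable_add)
      finally show ?thesis by (simp only: integral_divide_zero Bochner_Integration.integral_cnj)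
    qed
    have "(LINT x|N. (1 + Re (Z x)) * indicator A (X x)) = (LINT x|N'. (1 + Re (Z x)) * indicator A (X x))"
    proof (rule weighted_law_eqI[OF N N' sets X _ _ _ _ A, where C = 2])
      show "0 \<le> 1 + Re (Z x)" "1 + Re (Z x) \<le> 2" for x using R[of x] by linarith+
      show "(CLINT x|N. of_real (1 + Re (Z x)) * iexp (s * X x)) =
        (CLINT x|N'. of_real (1 + Re (Z x)) * iexp (s * X x))" for s
        using expand[of N s] expand[of N' s] law[of s] Zeq[of s] Zeq[of "-s"] by simp
    qed measurable
    moreover have "(LINT x|Q. (1 + Re (Z x)) * indicator A (X x)) =
        (LINT x|Q. indicator A (X x)) + (LINT x|Q. indicator A (X x) * Re (Z x))" if Q: "Q = N \<or> Q = N'" for Q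
    proof -
      have "(LINT x|Q. (1 + Re (Z x)) * indicator A (X x)) =
          (LINT x|Q. indicator A (X x) + indicator A (X x) * Re (Z x))"
        by (simp add: algebra_simps)
      also have "\<dots> = (LINT x|Q. indicator A (X x)) + (LINT x|Q. indicator A (X x) * Re (Z x))"
        using R by (intro Bochner_Integration.integral_add intr[OF Q]) (auto simp: abs_mult indicator_def)
      finally show ?thesis .
    qed
    ultimately show ?thesis using ind by simp
  qed
  \<comment> \<open>The imaginary part of \<open>Y\<close> is the real part of \<open>- \<i> Y\<close>.\<close>
  have "(CLINT x|N. (- \<i> * Y x) * iexp (s * X x)) = (CLINT x|N'. (- \<i> * Y x) * iexp (s * X x))" for s
    using eq[of s] by (simp only: mult.assoc integral_mult_right_zero)
  then have Im: "(LINT x|N. indicator A (X x) * Im (Y x)) = (LINT x|N'. indicator A (X x) * Im (Y x))"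
    using Re[of "\<lambda>x. - \<i> * Y x"] bound by (simp add: norm_mult)
  have split: "(CLINT x|Q. indicator A (X x) * Y x) =
      Complex (LINT x|Q. indicator A (X x) * Re (Y x)) (LINT x|Q. indicator A (X x) * Im (Y x))"
    if Q: "Q = N \<or> Q = N'" for Q
  proof -
    have "integrable Q (\<lambda>x. indicator A (X x) * Y x)"
      using bound by (intro int[OF Q]) (auto simp: norm_mult indicator_def)
    then show ?thesis
      by (intro complex_eqI) (auto simp flip: integral_Re integral_Im simp: indicator_def intro!: Bochner_Integration.integral_cong)
  qed
  show ?thesis using split Re[OF Y bound eq] Im by simp
qed

lemma borel_measurable_coordinate:
  assumes "sets N = sets (Pi\<^sub>M I (\<lambda>_. borel))" "i \<in> I"
  shows "(\<lambda>x. x i) \<in> borel_measurable N"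
  unfolding measurable_cong_sets[OF assms(1) refl] using assms(2) by (rule measurable_component_singleton)

lemma borel_measurable_linear_combination:
  fixes t :: "'i \<Rightarrow> real"
  assumes "sets N = sets (Pi\<^sub>M I (\<lambda>_. borel))" "J \<subseteq> I"
  shows "(\<lambda>x. \<Sum>i\<in>J. t i * x i) \<in> borel_measurable N"
proof (rule borel_measurable_sum)
  fix i assume "i \<in> J"
  then have "i \<in> I" using assms(2) by auto
  then show "(\<lambda>x. t i * x i) \<in> borel_measurable N"
    by (rule borel_measurable_times[OF borel_measurable_const borel_measurable_coordinate[OF assms(1)]])
qed

text \<open>Fourier uniqueness in finite dimension, reduced to the line one coordinate at a time: the exponential
  factors \<open>exp(i t\<^sub>k x\<^sub>k)\<close> are replaced by indicator factors of Borel sets for a growing set \<open>J\<close> of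
  coordinates. Each replacement is the one-dimensional statement for the coordinate \<open>x\<^sub>k\<close>, weighted by the
  product of all the other factors. When \<open>J = I\<close>, the integrals are the measures of boxes.\<close>

theorem finite_product_char_unique:
  fixes N N' :: "('i \<Rightarrow> real) measure"
  assumes I: "finite I" and N: "finite_measure N" and N': "finite_measure N'"
    and sets_N: "sets N = sets (Pi\<^sub>M I (\<lambda>_. borel))" and sets_N': "sets N' = sets (Pi\<^sub>M I (\<lambda>_. borel))"
    and char: "\<And>t. (CLINT x|N. iexp (\<Sum>i\<in>I. t i * x i)) = (CLINT x|N'. iexp (\<Sum>i\<in>I. t i * x i))"
  shows "N = N'"
proof -
  have sets: "sets N' = sets N" using sets_N sets_N' by simp
  note proj = borel_measurable_coordinate[OF sets_N]
  define ind where "ind J A x = (\<Prod>i\<in>J. indicator (A i) (x i) :: complex)" for J A and x :: "'i \<Rightarrow> real"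
  have norm_ind: "norm (ind J A x) \<le> 1" for J A x
    unfolding ind_def prod_norm[symmetric] by (intro prod_le_1) (auto simp: indicator_def)
  have "(CLINT x|N. ind J A x * iexp (\<Sum>i\<in>I-J. t i * x i)) = (CLINT x|N'. ind J A x * iexp (\<Sum>i\<in>I-J. t i * x i))"
    if "finite J" "J \<subseteq> I" "\<And>i. i \<in> I \<Longrightarrow> A i \<in> sets borel" for J A t
    using that
  proof (induction J arbitrary: t rule: finite_induct)
    case empty
    then show ?case using char[of t] by (simp add: ind_def)
  next
    case (insert k J)
    note [measurable] = insert.prems(2)
    have J: "J \<subseteq> I" and k [simp]: "k \<in> I" using insert.prems by auto
    let ?Y = "\<lambda>x. ind J A x * iexp (\<Sum>i\<in>I - insert k J. t i * x i)"
    have "(CLINT x|N. indicator (A k) (x k) * ?Y x) = (CLINT x|N'. indicator (A k) (x k) * ?Y x)"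
    proof (rule complex_weighted_law_eqI[OF N N' sets])
      show "(\<lambda>x. x k) \<in> borel_measurable N" by (rule proj) simp
      show "A k \<in> sets borel" by (rule insert.prems(2)) simp
      show "?Y \<in> borel_measurable N"
      proof (rule borel_measurable_times)
        show "ind J A \<in> borel_measurable N"
          unfolding ind_def[abs_def] using J insert.prems(2)
          by (intro borel_measurable_prod) (rule measurable_compose[OF proj borel_measurable_indicator]; blast)
        have "(\<lambda>x. \<Sum>i\<in>I - insert k J. t i * x i) \<in> borel_measurable N"
          by (rule borel_measurable_linear_combination[OF sets_N]) auto
        then show "(\<lambda>x. iexp (\<Sum>i\<in>I - insert k J. t i * x i)) \<in> borel_measurable N"
          by (rule measurable_compose) measurable
      qed
      show "norm (?Y x) \<le> 1" for x using norm_ind by (simp add: norm_mult)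
      fix s :: real
      \<comment> \<open>Frequencies supported on \<open>k\<close> give the characteristic function of the coordinate \<open>x k\<close> alone.\<close>
      have "(\<Sum>i\<in>I. (if i = k then s else 0) * x i) = s * x k" for x :: "'i \<Rightarrow> real"
        using I by (subst sum.remove[of _ k]) (auto intro!: sum.neutral)
      then show "(CLINT x|N. iexp (s * x k)) = (CLINT x|N'. iexp (s * x k))"
        using char[of "\<lambda>i. if i = k then s else 0"] by simp
      have "(\<Sum>i\<in>I-J. (t(k := s)) i * x i) = s * x k + (\<Sum>i\<in>I - insert k J. t i * x i)" for x :: "'i \<Rightarrow> real"
      proof -
        have "(\<Sum>i\<in>I-J. (t(k := s)) i * x i) = (t(k := s)) k * x k + (\<Sum>i\<in>I-J-{k}. (t(k := s)) i * x i)"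
          using I insert.hyps by (intro sum.remove) auto
        also have "(\<Sum>i\<in>I-J-{k}. (t(k := s)) i * x i) = (\<Sum>i\<in>I - insert k J. t i * x i)"
          by (rule sum.cong) auto
        finally show ?thesis by simp
      qed
      then have "ind J A x * iexp (\<Sum>i\<in>I-J. (t(k := s)) i * x i) = ?Y x * iexp (s * x k)" for x
        by (simp add: exp_add algebra_simps)
      then show "(CLINT x|N. ?Y x * iexp (s * x k)) = (CLINT x|N'. ?Y x * iexp (s * x k))"
        using insert.IH[OF J insert.prems(2), of "t(k := s)"] by (simp only:)
    qed
    then show ?case using insert.hyps by (simp add: ind_def mult.assoc)
  qed
  from this[OF I subset_refl] have ind_eq: "(CLINT x|N. ind I A x) = (CLINT x|N'. ind I A x)"
    if "\<And>i. i \<in> I \<Longrightarrow> A i \<in> sets borel" for A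
    using that by simp
  have box: "(CLINT x|Q. ind I A x) = of_real (measure Q (Pi\<^sub>E I A))"
    if Q: "sets Q = sets (Pi\<^sub>M I (\<lambda>_. borel))" "finite_measure Q" and A: "\<And>i. i \<in> I \<Longrightarrow> A i \<in> sets borel" for Q A
  proof -
    have sp: "space Q = (\<Pi>\<^sub>E i\<in>I. UNIV)" using sets_eq_imp_space_eq[OF Q(1)] by (simp add: space_PiM)
    have "Pi\<^sub>E I A \<in> sets Q" using A I unfolding Q(1) by (intro sets_PiM_I_finite) auto
    moreover have "ind I A x = of_real (indicator (Pi\<^sub>E I A) x)" if xQ: "x \<in> space Q" for x
    proof (cases "x \<in> Pi\<^sub>E I A")
      case True
      then have "x i \<in> A i" if "i \<in> I" for i using that by (auto simp: PiE_iff)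
      then show ?thesis using True by (auto simp: ind_def intro!: prod.neutral)
    next
      case False
      then obtain i where "i \<in> I" "x i \<notin> A i" using xQ unfolding sp by (auto simp: PiE_iff)
      then have "ind I A x = 0" using I unfolding ind_def by (intro prod_zero bexI[of _ i]) auto
      then show ?thesis using False by simp
    qed
    moreover have "Pi\<^sub>E I A \<inter> (\<Pi>\<^sub>E i\<in>I. UNIV) = Pi\<^sub>E I A" by auto
    ultimately show ?thesis
      by (subst Bochner_Integration.integral_cong[OF refl, of _ _ "\<lambda>x. of_real (indicator (Pi\<^sub>E I A) x)"]) (auto simp: sp)
  qed
  show ?thesis
  proof (rule measure_eqI_PiM_finite[OF I sets_N sets_N'])
    show "emeasure N (Pi\<^sub>E I A) = emeasure N' (Pi\<^sub>E I A)" if "\<And>i. i \<in> I \<Longrightarrow> A i \<in> sets borel" for A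
      using ind_eq[OF that] box[OF sets_N N that] box[OF sets_N' N' that]
      by (simp add: finite_measure.emeasure_eq_measure[OF N] finite_measure.emeasure_eq_measure[OF N'])
    show "range (\<lambda>_::nat. \<Pi>\<^sub>E i\<in>I. UNIV) \<subseteq> prod_algebra I (\<lambda>_. borel)"
      using I by (auto intro!: prod_algebraI_finite)
    show "(\<Union>_::nat. \<Pi>\<^sub>E i\<in>I. UNIV) = space (Pi\<^sub>M I (\<lambda>_. borel :: real measure))"
      by (simp add: space_PiM)
    show "emeasure N (\<Pi>\<^sub>E i\<in>I. UNIV) \<noteq> \<infinity>" for i :: nat
      using finite_measure.emeasure_finite[OF N] by simp
  qed
qed


lemma centered_gaussian_law_props:
  assumes "centered_gaussian D"
  shows centered_gaussian_prob: "prob_space D"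
    and centered_gaussian_square_integrable: "integrable D (\<lambda>x. x\<^sup>2)"
    and centered_gaussian_cases: "D = return borel 0 \<and> (LINT x|D. x\<^sup>2) = 0 \<or>
      (\<exists>\<sigma>>0. D = density lborel (normal_density 0 \<sigma>) \<and> (LINT x|D. x\<^sup>2) = \<sigma>\<^sup>2)"
proof -
  have normal: "has_bochner_integral (density lborel (normal_density 0 \<sigma>)) (\<lambda>x. x\<^sup>2) (\<sigma>\<^sup>2)" if "\<sigma> > 0" for \<sigma>
    using normal_moment_even[OF that, of 0 1] that
    by (intro has_bochner_integral_density) (auto simp: fact_numeral)
  have point: "has_bochner_integral (return borel (0::real)) (\<lambda>x. x\<^sup>2) 0"
    by (simp add: has_bochner_integral_iff integral_return integrable_iff_bounded nn_integral_return)
  note D = assms[unfolded centered_gaussian_def]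
  show "prob_space D" using D prob_space_normal_density prob_space_return[of "0::real" borel] by auto
  show "integrable D (\<lambda>x. x\<^sup>2)" using D normal point by (auto simp: has_bochner_integral_iff)
  show "D = return borel 0 \<and> (LINT x|D. x\<^sup>2) = 0 \<or>
      (\<exists>\<sigma>>0. D = density lborel (normal_density 0 \<sigma>) \<and> (LINT x|D. x\<^sup>2) = \<sigma>\<^sup>2)"
    using D normal point by (auto simp: has_bochner_integral_iff)
qed

lemma centered_gaussian_eqI:
  assumes "centered_gaussian D" "centered_gaussian D'" "(LINT x|D. x\<^sup>2) = (LINT x|D'. x\<^sup>2)"
  shows "D = D'"
  using centered_gaussian_cases[OF assms(1)] centered_gaussian_cases[OF assms(2)] assms(3)
  by auto

text \<open>Every coordinate is a linear combination, hence Gaussian and square integrable; so the products of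
  coordinates are integrable and the variance may be expanded.\<close>

lemma
  assumes "is_centered_gaussian_law n C N"
  shows is_centered_gaussian_law_prob: "prob_space N"
    and is_centered_gaussian_law_variance:
      "(LINT x|N. (\<Sum>i<n. t i * x i)\<^sup>2) = (\<Sum>i<n. \<Sum>j<n. t i * t j * C i j)"
proof -
  have sets: "sets N = sets (borel_power n)"
    and law: "\<And>t. centered_gaussian (distr N borel (\<lambda>x. \<Sum>i<n. t i * x i))"
    and cov: "\<And>i j. i < n \<Longrightarrow> j < n \<Longrightarrow> (LINT x|N. x i * x j) = C i j"
    using assms by (auto simp: is_centered_gaussian_law_def)
  have proj: "(\<lambda>x. x i) \<in> borel_measurable N" if "i < n" for i
    using borel_measurable_coordinate[OF sets] that by simp
  note comb = borel_measurable_linear_combination[OF sets subset_refl]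
  show "prob_space N"
    using centered_gaussian_prob[OF law] prob_space_distrD[OF comb] by blast
  have sq: "integrable N (\<lambda>x. (x i)\<^sup>2)" if i: "i < n" for i
  proof -
    have "(\<Sum>k<n. (if k = i then 1 else 0) * x k) = x i" for x :: "nat \<Rightarrow> real"
      using i by (subst sum.remove[of _ i]) (auto intro!: sum.neutral)
    then have "integrable (distr N borel (\<lambda>x. x i)) (\<lambda>x. x\<^sup>2)"
      using centered_gaussian_square_integrable[OF law[of "\<lambda>k. if k = i then 1 else 0"]] by simp
    then show ?thesis using integrable_distr_eq[OF proj[OF i], of "\<lambda>x. x\<^sup>2"] by simp
  qed
  have mixed: "integrable N (\<lambda>x. x i * x j)" if "i < n" "j < n" for i j
  proof (rule Bochner_Integration.integrable_bound)
    show "integrable N (\<lambda>x. (x i)\<^sup>2 + (x j)\<^sup>2)" using sq that by simp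
    show "(\<lambda>x. x i * x j) \<in> borel_measurable N" using proj that by simp
    have "\<bar>a * b\<bar> \<le> a\<^sup>2 + b\<^sup>2" for a b :: real
    proof -
      have "2 * (\<bar>a\<bar> * \<bar>b\<bar>) \<le> a\<^sup>2 + b\<^sup>2" using sum_squares_bound[of "\<bar>a\<bar>" "\<bar>b\<bar>"] by (simp add: mult.assoc)
      moreover have "0 \<le> \<bar>a\<bar> * \<bar>b\<bar>" by simp
      ultimately show ?thesis unfolding abs_mult by linarith
    qed
    then show "AE x in N. norm (x i * x j) \<le> norm ((x i)\<^sup>2 + (x j)\<^sup>2)" by simp
  qed
  have "(LINT x|N. (\<Sum>i<n. t i * x i)\<^sup>2) = (LINT x|N. (\<Sum>i<n. \<Sum>j<n. (t i * t j) * (x i * x j)))"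
    by (simp add: power2_eq_square sum_product algebra_simps)
  also have "\<dots> = (\<Sum>i<n. LINT x|N. (\<Sum>j<n. (t i * t j) * (x i * x j)))"
    by (intro Bochner_Integration.integral_sum Bochner_Integration.integrable_sum integrable_mult_right mixed) auto
  also have "\<dots> = (\<Sum>i<n. \<Sum>j<n. LINT x|N. (t i * t j) * (x i * x j))"
    by (intro sum.cong refl Bochner_Integration.integral_sum integrable_mult_right mixed) auto
  finally show "(LINT x|N. (\<Sum>i<n. t i * x i)\<^sup>2) = (\<Sum>i<n. \<Sum>j<n. t i * t j * C i j)"
    by (simp add: cov)
qed

text \<open>The argument of Cramer and Wold: the characteristic function of the joint law is a value of the
  characteristic function of a linear combination, and the Gaussian law of the latter is determined by
  its variance.\<close>

theorem centered_gaussian_law_unique: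
  assumes N: "is_centered_gaussian_law n C N" and N': "is_centered_gaussian_law n C N'"
  shows "N = N'"
proof (rule finite_product_char_unique[of "{..<n}"])
  show "finite_measure N" "finite_measure N'"
    using is_centered_gaussian_law_prob[OF N] is_centered_gaussian_law_prob[OF N']
    by (auto simp: prob_space_def)
  show sets: "sets N = sets (borel_power n)" "sets N' = sets (borel_power n)"
    using N N' by (auto simp: is_centered_gaussian_law_def)
  fix t :: "nat \<Rightarrow> real"
  let ?T = "\<lambda>x. \<Sum>i<n. t i * x i :: real"
  note comb = borel_measurable_linear_combination[OF _ subset_refl]
  have "distr N borel ?T = distr N' borel ?T"
  proof (rule centered_gaussian_eqI)
    show "centered_gaussian (distr N borel ?T)" "centered_gaussian (distr N' borel ?T)"
      using N N' by (auto simp: is_centered_gaussian_law_def)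
    show "(LINT x|distr N borel ?T. x\<^sup>2) = (LINT x|distr N' borel ?T. x\<^sup>2)"
      using is_centered_gaussian_law_variance[OF N] is_centered_gaussian_law_variance[OF N']
      by (simp add: integral_distr comb sets)
  qed
  then have "(CLINT y|distr N borel ?T. iexp y) = (CLINT y|distr N' borel ?T. iexp y)" by simp
  then show "(CLINT x|N. iexp (?T x)) = (CLINT x|N'. iexp (?T x))"
    by (simp add: integral_distr comb sets)
qed simp

lemma centered_gaussian_law_eq:
  "is_centered_gaussian_law n C N \<Longrightarrow> centered_gaussian_law n C = N"
  unfolding centered_gaussian_law_def by (rule the_equality) (auto intro: centered_gaussian_law_unique)

section \<open>The algebra of cylinders\<close>

lemma set_algebra_boolean_lattice:
  assumes "algebra \<Omega> \<C>"
  defines "B \<equiv> \<lparr>carrier = \<C>, eq = (=), le = (\<subseteq>)\<rparr>"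
  shows "boolean_lattice B"
    and "\<bottom>\<^bsub>B\<^esub> = {}" and "\<top>\<^bsub>B\<^esub> = \<Omega>"
    and "\<lbrakk>X \<in> \<C>; Y \<in> \<C>\<rbrakk> \<Longrightarrow> X \<squnion>\<^bsub>B\<^esub> Y = X \<union> Y"
    and "X \<in> \<C> \<Longrightarrow> lattice_compl B X = \<Omega> - X"
proof -
  interpret C: algebra \<Omega> \<C> by fact
  have [simp]: "carrier B = \<C>" "le B = (\<subseteq>)" "eq B = (=)" by (simp_all add: B_def)
  interpret partial_order B by unfold_locales auto
  have lub: "is_lub B (X \<union> Y) {X, Y}" and glb: "is_glb B (X \<inter> Y) {X, Y}" if "X \<in> \<C>" "Y \<in> \<C>" for X Y
    using that by (auto simp: least_def greatest_def Upper_def Lower_def)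
  have bot: "least B {} (carrier B)" and top: "greatest B \<Omega> (carrier B)"
    using C.sets_into_space by (auto simp: least_def greatest_def)
  interpret bounded_lattice B
  proof unfold_locales
    fix X Y assume "X \<in> carrier B" "Y \<in> carrier B"
    then show "\<exists>s. is_lub B s {X, Y}" "\<exists>s. is_glb B s {X, Y}"
      using lub[of X Y] glb[of X Y] by auto
  qed (use bot top in blast)+
  have join: "X \<squnion>\<^bsub>B\<^esub> Y = X \<union> Y" and meet: "X \<sqinter>\<^bsub>B\<^esub> Y = X \<inter> Y" if "X \<in> \<C>" "Y \<in> \<C>" for X Y
    using least_unique[OF sup_of_two_least lub] greatest_unique[OF inf_of_two_greatest glb] that
    by (simp_all add: Lattice.join_def meet_def)
  have bot': "\<bottom>\<^bsub>B\<^esub> = {}" and top': "\<top>\<^bsub>B\<^esub> = \<Omega>"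
    using least_unique[OF bottom_least bot] greatest_unique[OF top_greatest top] .
  have compl: "X \<squnion>\<^bsub>B\<^esub> (\<Omega> - X) = \<top>\<^bsub>B\<^esub>" "X \<sqinter>\<^bsub>B\<^esub> (\<Omega> - X) = \<bottom>\<^bsub>B\<^esub>" if "X \<in> \<C>" for X
    using join[OF that C.compl_sets[OF that]] meet[OF that C.compl_sets[OF that]] C.sets_into_space[OF that]
    by (auto simp: bot' top')
  show "boolean_lattice B"
  proof unfold_locales
    show "X \<sqinter>\<^bsub>B\<^esub> (Y \<squnion>\<^bsub>B\<^esub> Z) = (X \<sqinter>\<^bsub>B\<^esub> Y) \<squnion>\<^bsub>B\<^esub> (X \<sqinter>\<^bsub>B\<^esub> Z)"
      if "X \<in> carrier B" "Y \<in> carrier B" "Z \<in> carrier B" for X Y Z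
      using that by (simp add: join meet C.Un C.Int Int_Un_distrib)
    show "\<exists>Y\<in>carrier B. X \<squnion>\<^bsub>B\<^esub> Y = \<top>\<^bsub>B\<^esub> \<and> X \<sqinter>\<^bsub>B\<^esub> Y = \<bottom>\<^bsub>B\<^esub>" if "X \<in> carrier B" for X
      using that compl[of X] by (intro bexI[of _ "\<Omega> - X"]) auto
  qed
  then interpret boolean_gorder B by (simp add: boolean_gorder_def)
  show "lattice_compl B X = \<Omega> - X" if "X \<in> \<C>"
    using that compl by (intro lattice_compl_eqI) auto
  show "X \<squnion>\<^bsub>B\<^esub> Y = X \<union> Y" if "X \<in> \<C>" "Y \<in> \<C>" by (rule join[OF that])
  show "\<bottom>\<^bsub>B\<^esub> = {}" "\<top>\<^bsub>B\<^esub> = \<Omega>" by (fact bot' top')+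
qed

text \<open>Concatenate the two families of vectors and pull the two base sets back along the coordinate projections.\<close>

lemma cylinder_common_presentation:
  assumes S: "S \<in> sets (borel_power n)" and T: "T \<in> sets (borel_power m)"
  obtains c S' T' where "S' \<in> sets (borel_power (n + m))" "T' \<in> sets (borel_power (n + m))"
    "cylinder n a S = cylinder (n + m) c S'" "cylinder m b T = cylinder (n + m) c T'"
proof -
  let ?P = "borel_power (n + m)"
  define c where "c i = (if i < n then a i else b (i - n))" for i
  define p where "p = (\<lambda>y::nat \<Rightarrow> real. \<lambda>i\<in>{..<n}. y i)"
  define q where "q = (\<lambda>y::nat \<Rightarrow> real. \<lambda>i\<in>{..<m}. y (i + n))"
  have p: "p \<in> ?P \<rightarrow>\<^sub>M borel_power n" and q: "q \<in> ?P \<rightarrow>\<^sub>M borel_power m"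
    unfolding p_def q_def by (intro measurable_restrict measurable_component_singleton; simp)+
  have space: "(\<lambda>i\<in>{..<n + m}. inner (c i) x) \<in> space ?P" for x
    by (simp add: space_PiM)
  have "p (\<lambda>i\<in>{..<n + m}. inner (c i) x) = (\<lambda>i\<in>{..<n}. inner (a i) x)"
    "q (\<lambda>i\<in>{..<n + m}. inner (c i) x) = (\<lambda>i\<in>{..<m}. inner (b i) x)" for x
    by (auto simp: p_def q_def c_def fun_eq_iff restrict_def)
  then have "cylinder n a S = cylinder (n + m) c (p -` S \<inter> space ?P)"
    "cylinder m b T = cylinder (n + m) c (q -` T \<inter> space ?P)"
    using space by (auto simp: cylinder_def)
  then show thesis
    using that measurable_sets[OF p S] measurable_sets[OF q T] by blast
qed

lemma carrier_cylinder_algebra: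
  "carrier cylinder_algebra = {cylinder n a S | n a S. n \<ge> 1 \<and> S \<in> sets (borel_power n)}"
  by (simp add: cylinder_algebra_def)

lemma cylinder_in_carrier: "n \<ge> 1 \<Longrightarrow> S \<in> sets (borel_power n) \<Longrightarrow> cylinder n a S \<in> carrier cylinder_algebra"
  by (auto simp: carrier_cylinder_algebra)

lemma algebra_cylinders: "algebra UNIV (carrier cylinder_algebra)"
  unfolding algebra_iff_Un
proof (intro conjI ballI)
  have "cylinder 1 (\<lambda>_. 0) {} = ({} :: 'a set)" by (auto simp: cylinder_def)
  then show "{} \<in> carrier (cylinder_algebra :: 'a set gorder)"
    using cylinder_in_carrier[of 1 "{}" "\<lambda>_. 0 :: 'a"] by simp
next
  fix A :: "'a set" assume "A \<in> carrier cylinder_algebra"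
  then obtain n a S where A: "n \<ge> 1" "S \<in> sets (borel_power n)" "A = cylinder n a S"
    by (auto simp: carrier_cylinder_algebra)
  have "UNIV - A = cylinder n a (space (borel_power n) - S)"
    using A by (auto simp: cylinder_def space_PiM)
  then show "UNIV - A \<in> carrier cylinder_algebra"
    using A by (auto intro!: cylinder_in_carrier)
next
  fix A B :: "'a set" assume "A \<in> carrier cylinder_algebra" "B \<in> carrier cylinder_algebra"
  then obtain n a S m b T where A: "n \<ge> 1" "S \<in> sets (borel_power n)" "A = cylinder n a S"
    and B: "m \<ge> 1" "T \<in> sets (borel_power m)" "B = cylinder m b T"
    by (auto simp: carrier_cylinder_algebra)
  obtain c S' T' where c: "S' \<in> sets (borel_power (n + m))" "T' \<in> sets (borel_power (n + m))"
    "A = cylinder (n + m) c S'" "B = cylinder (n + m) c T'"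
    using cylinder_common_presentation[OF A(2) B(2)] A(3) B(3) by metis
  have "A \<union> B = cylinder (n + m) c (S' \<union> T')"
    unfolding c(3,4) by (auto simp: cylinder_def)
  then show "A \<union> B \<in> carrier cylinder_algebra"
    using A B c by (auto intro!: cylinder_in_carrier)
qed simp

lemmas cylinder_algebra_lattice =
  set_algebra_boolean_lattice[OF algebra_cylinders, folded cylinder_algebra_def[unfolded carrier_cylinder_algebra[symmetric]]]

section \<open>Cylinders as events of a Gaussian probability space\<close>

lemma sigma_generated_by_mono:
  "sigma_generated_by L G \<Longrightarrow> G \<subseteq> G' \<Longrightarrow> sigma_generated_by L G'"
  unfolding sigma_generated_by_def by blast

context gaussian_probability_space
begin

lemma representatives:
  obtains f where "f \<in> borel_measurable M" "\<alpha> h = {g \<in> borel_measurable M. AE \<omega> in M. f \<omega> = g \<omega>}"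
proof -
  have "\<alpha> h \<in> L2_space M" using embedding by (simp add: L2_embedding_def)
  then show thesis by (auto simp: L2_space_def quotient_def intro!: that)
qed

lemma representative_exists: "\<exists>f. f \<in> \<alpha> h"
  using representatives[of h] by (metis (mono_tags, lifting) AE_I2 mem_Collect_eq)

lemma representative_measurable: "f \<in> \<alpha> h \<Longrightarrow> f \<in> borel_measurable M"
  using representatives[of h] by blast

lemma representatives_AE_eq:
  assumes "f \<in> \<alpha> h" "g \<in> \<alpha> h"
  shows "AE \<omega> in M. f \<omega> = g \<omega>"
proof -
  obtain f0 where "\<alpha> h = {g \<in> borel_measurable M. AE \<omega> in M. f0 \<omega> = g \<omega>}" by (rule representatives)
  then have "AE \<omega> in M. f0 \<omega> = f \<omega>" "AE \<omega> in M. f0 \<omega> = g \<omega>" using assms by auto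
  then show ?thesis by eventually_elim simp
qed

lemma representative_add: "\<lbrakk>f \<in> \<alpha> h; g \<in> \<alpha> k\<rbrakk> \<Longrightarrow> (\<lambda>\<omega>. f \<omega> + g \<omega>) \<in> \<alpha> (h + k)"
  and representative_scale: "f \<in> \<alpha> h \<Longrightarrow> (\<lambda>\<omega>. c * f \<omega>) \<in> \<alpha> (c *\<^sub>R h)"
  and representative_inner: "\<lbrakk>f \<in> \<alpha> h; g \<in> \<alpha> k\<rbrakk> \<Longrightarrow> (LINT \<omega>|M. f \<omega> * g \<omega>) = inner h k"
  using embedding by (simp_all add: L2_embedding_def)

lemma representative_linear_combination:
  assumes "finite I" "\<And>i. i \<in> I \<Longrightarrow> f i \<in> \<alpha> (a i)"
  shows "(\<lambda>\<omega>. \<Sum>i\<in>I. t i * f i \<omega>) \<in> \<alpha> (\<Sum>i\<in>I. t i *\<^sub>R a i)"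
  using assms
proof (induction I)
  case empty
  obtain f where "f \<in> \<alpha> 0" using representative_exists by blast
  then have "(\<lambda>\<omega>. 0 * f \<omega>) \<in> \<alpha> (0 *\<^sub>R 0)" by (rule representative_scale)
  then show ?case by simp
next
  case (insert k I)
  have "(\<lambda>\<omega>. t k * f k \<omega>) \<in> \<alpha> (t k *\<^sub>R a k)"
    using insert.prems[of k] by (intro representative_scale) auto
  moreover have "(\<lambda>\<omega>. \<Sum>i\<in>I. t i * f i \<omega>) \<in> \<alpha> (\<Sum>i\<in>I. t i *\<^sub>R a i)"
    using insert by simp
  ultimately have "(\<lambda>\<omega>. t k * f k \<omega> + (\<Sum>i\<in>I. t i * f i \<omega>)) \<in> \<alpha> (t k *\<^sub>R a k + (\<Sum>i\<in>I. t i *\<^sub>R a i))"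
    by (rule representative_add)
  then show ?case using insert.hyps by simp
qed

lemma joint_law_is_centered_gaussian:
  assumes f: "\<And>i. i < n \<Longrightarrow> f i \<in> \<alpha> (a i)"
  shows "is_centered_gaussian_law n (\<lambda>i j. inner (a i) (a j)) (distr M (borel_power n) (\<lambda>\<omega>. \<lambda>i\<in>{..<n}. f i \<omega>))"
  unfolding is_centered_gaussian_law_def
proof (intro conjI allI impI)
  let ?F = "\<lambda>\<omega>. \<lambda>i\<in>{..<n}. f i \<omega>"
  have F: "?F \<in> M \<rightarrow>\<^sub>M borel_power n"
    using representative_measurable[OF f] by (intro measurable_restrict) simp
  show "sets (distr M (borel_power n) ?F) = sets (borel_power n)" by simp
  show "centered_gaussian (distr (distr M (borel_power n) ?F) borel (\<lambda>x. \<Sum>i<n. t i * x i))" for t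
  proof -
    have "distr (distr M (borel_power n) ?F) borel (\<lambda>x. \<Sum>i<n. t i * x i) =
        distr M borel ((\<lambda>x. \<Sum>i<n. t i * x i) \<circ> ?F)"
      by (rule distr_distr[OF borel_measurable_linear_combination[OF refl subset_refl] F])
    also have "(\<lambda>x. \<Sum>i<n. t i * x i) \<circ> ?F = (\<lambda>\<omega>. \<Sum>i<n. t i * f i \<omega>)"
      by (auto simp: fun_eq_iff)
    finally have eq: "distr (distr M (borel_power n) ?F) borel (\<lambda>x. \<Sum>i<n. t i * x i) =
        distr M borel (\<lambda>\<omega>. \<Sum>i<n. t i * f i \<omega>)" .
    show ?thesis
      unfolding eq using f by (intro gaussian[OF representative_linear_combination]) auto
  qed
  fix i j assume ij: "i < n" "j < n"
  have coord: "(\<lambda>x. x k) \<in> borel_measurable (borel_power n)" if "k < n" for k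
    using that by (intro borel_measurable_coordinate[OF refl]) simp
  have "(LINT x|distr M (borel_power n) ?F. x i * x j) = (LINT \<omega>|M. f i \<omega> * f j \<omega>)"
    using ij by (subst integral_distr[OF F borel_measurable_times[OF coord coord]]) auto
  also have "\<dots> = inner (a i) (a j)"
    by (rule representative_inner[OF f[OF ij(1)] f[OF ij(2)]])
  finally show "(LINT x|distr M (borel_power n) ?F. x i * x j) = inner (a i) (a j)" .
qed

text \<open>Take an orthogonal basis \<open>E\<close> of the span of \<open>C\<close>, a representative \<open>h\<^sub>e\<close> of each \<open>\<alpha> e\<close>, and let \<open>x\<close> be the
  random vector in the span of \<open>E\<close> with coordinates \<open>\<langle>e, x\<rangle> = h\<^sub>e\<close>. Since \<open>\<alpha>\<close> is linear up to null sets,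
  \<open>\<langle>c, x\<rangle> = \<alpha> c\<close> holds almost surely for every \<open>c\<close> in the span. Only finitely many \<open>c\<close> are allowed, since
  \<open>x\<close> and the null set depend on them.\<close>

lemma representatives_sampled_by_vector:
  assumes C: "finite C" and g: "\<And>c. c \<in> C \<Longrightarrow> g c \<in> \<alpha> c"
  shows "\<exists>x. AE \<omega> in M. \<forall>c\<in>C. g c \<omega> = inner c (x \<omega>)"
proof -
  obtain D where D: "finite D" "span D = span C" "pairwise orthogonal D"
    using basis_orthogonal[OF C] by auto
  \<comment> \<open>The orthogonal family may contain zero, which would spoil the division by \<open>inner e e\<close>.\<close>
  define E where "E = D - {0}"
  have E: "finite E" "span E = span C" "0 \<notin> E"
    using D span_delete_0[of D] by (auto simp: E_def)
  have orth: "inner e e' = 0" if "e \<in> E" "e' \<in> E" "e \<noteq> e'" for e e'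
    using that D(3) by (auto simp: E_def pairwise_def orthogonal_def)
  have "\<forall>c\<in>C. \<exists>u. c = (\<Sum>e\<in>E. u e *\<^sub>R e)"
  proof
    fix c assume "c \<in> C"
    then have "c \<in> span E" unfolding E(2) by (rule span_base)
    then show "\<exists>u. c = (\<Sum>e\<in>E. u e *\<^sub>R e)" unfolding span_finite[OF E(1)] by auto
  qed
  then obtain u where u: "\<And>c. c \<in> C \<Longrightarrow> c = (\<Sum>e\<in>E. u c e *\<^sub>R e)" by metis
  obtain h where h: "\<And>e. h e \<in> \<alpha> e" using representative_exists by metis
  define x where "x \<omega> = (\<Sum>e\<in>E. (h e \<omega> / inner e e) *\<^sub>R e)" for \<omega>
  have coord: "inner e (x \<omega>) = h e \<omega>" if "e \<in> E" for e \<omega>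
  proof -
    have "inner e (x \<omega>) = (\<Sum>e'\<in>E. (h e' \<omega> / inner e' e') * inner e e')"
      by (simp add: x_def inner_sum_right)
    also have "\<dots> = (\<Sum>e'\<in>E. if e' = e then h e \<omega> else 0)"
      using that orth[of e] E(3) by (intro sum.cong) auto
    also have "\<dots> = h e \<omega>" using that E(1) by simp
    finally show ?thesis .
  qed
  have "AE \<omega> in M. g c \<omega> = inner c (x \<omega>)" if c: "c \<in> C" for c
  proof -
    have "(\<lambda>\<omega>. \<Sum>e\<in>E. u c e * h e \<omega>) \<in> \<alpha> (\<Sum>e\<in>E. u c e *\<^sub>R e)"
      by (rule representative_linear_combination[OF E(1) h])
    then have "(\<lambda>\<omega>. \<Sum>e\<in>E. u c e * h e \<omega>) \<in> \<alpha> c" using u[OF c] by simp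
    then have "AE \<omega> in M. g c \<omega> = (\<Sum>e\<in>E. u c e * h e \<omega>)"
      by (rule representatives_AE_eq[OF g[OF c]])
    moreover have "inner c (x \<omega>) = (\<Sum>e\<in>E. u c e * h e \<omega>)" for \<omega>
    proof -
      have "inner c (x \<omega>) = inner (\<Sum>e\<in>E. u c e *\<^sub>R e) (x \<omega>)" using u[OF c] by simp
      also have "\<dots> = (\<Sum>e\<in>E. u c e * h e \<omega>)"
        by (simp add: inner_sum_left coord)
      finally show ?thesis .
    qed
    ultimately show ?thesis by simp
  qed
  then show ?thesis using C by (auto simp: AE_finite_all)
qed

text \<open>A relation rather than a function, because \<open>E\<close> depends on the presentation of the cylinder and on the
  representatives \<open>f\<^sub>i\<close>; its class does not (\<open>represents_class_unique\<close>).\<close>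

definition represents :: "'h set \<Rightarrow> 'x set \<Rightarrow> bool" where
  "represents A E \<longleftrightarrow> (\<exists>n a S f. n \<ge> 1 \<and> S \<in> sets (borel_power n) \<and> (\<forall>i<n. f i \<in> \<alpha> (a i)) \<and>
     A = cylinder n a S \<and> E = {\<omega> \<in> space M. (\<lambda>i\<in>{..<n}. f i \<omega>) \<in> S})"

lemma represents_measurable:
  assumes "represents A E"
  shows "E \<in> sets M"
proof -
  obtain n a S f where f: "S \<in> sets (borel_power n)" "\<forall>i<n. f i \<in> \<alpha> (a i)"
    and E: "E = {\<omega> \<in> space M. (\<lambda>i\<in>{..<n}. f i \<omega>) \<in> S}"
    using assms by (auto simp: represents_def)
  have "(\<lambda>\<omega>. \<lambda>i\<in>{..<n}. f i \<omega>) \<in> M \<rightarrow>\<^sub>M borel_power n"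
    using f(2) representative_measurable by (intro measurable_restrict) auto
  from measurable_sets[OF this f(1)] show ?thesis
    unfolding E by (simp add: vimage_def Int_def conj_commute)
qed

lemma represents_exists:
  assumes "A \<in> carrier cylinder_algebra"
  obtains E where "represents A E"
proof -
  obtain n a S where "n \<ge> 1" "S \<in> sets (borel_power n)" "A = cylinder n a S"
    using assms by (auto simp: carrier_cylinder_algebra)
  moreover obtain h where "\<And>c. h c \<in> \<alpha> c" using representative_exists by metis
  ultimately have "represents A {\<omega> \<in> space M. (\<lambda>i\<in>{..<n}. h (a i) \<omega>) \<in> S}"
    unfolding represents_def by (intro exI[of _ n] exI[of _ a] exI[of _ S] exI[of _ "\<lambda>i. h (a i)"]) auto
  then show thesis by (rule that)
qed

text \<open>One random vector serves finitely many cylinders at once: apply \<open>representatives_sampled_by_vector\<close> to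
  all the vectors that occur in their presentations. Every set-theoretic relation between the cylinders
  then holds almost surely between the events.\<close>

lemma represents_sampled:
  assumes fin: "finite R" and R: "\<And>A E. (A, E) \<in> R \<Longrightarrow> represents A E"
  shows "\<exists>x. AE \<omega> in M. \<forall>(A, E)\<in>R. \<omega> \<in> E \<longleftrightarrow> x \<omega> \<in> A"
proof -
  have "\<forall>r\<in>R. \<exists>n a S f. (\<forall>i<n. f i \<in> \<alpha> (a i)) \<and> fst r = cylinder n a S \<and>
      snd r = {\<omega> \<in> space M. (\<lambda>i\<in>{..<n}. f i \<omega>) \<in> S}"
  proof
    fix r assume "r \<in> R"
    then have "represents (fst r) (snd r)" using R[of "fst r" "snd r"] by simp
    then show "\<exists>n a S f. (\<forall>i<n. f i \<in> \<alpha> (a i)) \<and> fst r = cylinder n a S \<and>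
      snd r = {\<omega> \<in> space M. (\<lambda>i\<in>{..<n}. f i \<omega>) \<in> S}"
      unfolding represents_def by blast
  qed
  then obtain n a S f where "\<forall>r\<in>R. (\<forall>i<n r. f r i \<in> \<alpha> (a r i)) \<and> fst r = cylinder (n r) (a r) (S r) \<and>
      snd r = {\<omega> \<in> space M. (\<lambda>i\<in>{..<n r}. f r i \<omega>) \<in> S r}"
    unfolding bchoice_iff by blast
  then have f: "\<And>r i. r \<in> R \<Longrightarrow> i < n r \<Longrightarrow> f r i \<in> \<alpha> (a r i)"
    and A: "\<And>r. r \<in> R \<Longrightarrow> fst r = cylinder (n r) (a r) (S r)"
    and E: "\<And>r. r \<in> R \<Longrightarrow> snd r = {\<omega> \<in> space M. (\<lambda>i\<in>{..<n r}. f r i \<omega>) \<in> S r}"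
    by blast+
  define C where "C = (\<Union>r\<in>R. a r ` {..<n r})"
  have "finite C" using fin by (simp add: C_def)
  moreover obtain g where g: "\<And>c. g c \<in> \<alpha> c" using representative_exists by metis
  ultimately obtain x where x: "AE \<omega> in M. \<forall>c\<in>C. g c \<omega> = inner c (x \<omega>)"
    using representatives_sampled_by_vector by blast
  have "AE \<omega> in M. \<forall>r\<in>R. \<forall>i\<in>{..<n r}. f r i \<omega> = g (a r i) \<omega>"
    using representatives_AE_eq[OF f g] fin by (simp add: AE_finite_all)
  with x have "AE \<omega> in M. \<forall>r\<in>R. \<omega> \<in> snd r \<longleftrightarrow> x \<omega> \<in> fst r"
    using AE_space
  proof eventually_elim
    case (elim \<omega>)
    show ?case
    proof
      fix r assume r: "r \<in> R"
      have "f r i \<omega> = inner (a r i) (x \<omega>)" if "i < n r" for i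
        using elim r that by (auto simp: C_def)
      then have "(\<lambda>i\<in>{..<n r}. f r i \<omega>) = (\<lambda>i\<in>{..<n r}. inner (a r i) (x \<omega>))"
        by (intro restrict_ext) auto
      then show "\<omega> \<in> snd r \<longleftrightarrow> x \<omega> \<in> fst r"
        using elim(3) by (simp add: A[OF r] E[OF r] cylinder_def)
    qed
  qed
  then show ?thesis by (intro exI[of _ x]) (auto simp: case_prod_beta)
qed

lemma represents_class_unique:
  assumes "represents A E" "represents A F"
  shows "null_class M E = null_class M F"
proof -
  obtain x where "AE \<omega> in M. \<forall>(A, E)\<in>{(A, E), (A, F)}. \<omega> \<in> E \<longleftrightarrow> x \<omega> \<in> A"
    using represents_sampled[of "{(A, E), (A, F)}"] assms by auto
  then have "AE \<omega> in M. \<omega> \<in> E \<longleftrightarrow> \<omega> \<in> F" by eventually_elim auto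
  then show ?thesis using assms by (simp add: null_class_eq_iff represents_measurable)
qed

definition cylinder_class :: "'h set \<Rightarrow> 'x set set" where
  "cylinder_class A = null_class M (SOME E. represents A E)"

lemma cylinder_class_eq: "represents A E \<Longrightarrow> cylinder_class A = null_class M E"
  unfolding cylinder_class_def by (rule represents_class_unique[OF someI])

text \<open>For a presentation by \<open>a\<close> and \<open>S\<close>, the Gaussian law with covariance \<open>\<langle>a\<^sub>i, a\<^sub>j\<rangle>\<close> is the joint law of the
  \<open>f\<^sub>i\<close>. Other presentations of the same cylinder give an event of the same class, hence the same value; so
  the definite description in \<^const>\<open>gaussian_additive\<close> is well defined.\<close>

lemma gaussian_additive_eq:
  assumes "represents A E"
  shows "gaussian_additive A = emeasure M E"
proof -
  have law: "emeasure (centered_gaussian_law n (\<lambda>i j. inner (a i) (a j))) S =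
      emeasure M {\<omega> \<in> space M. (\<lambda>i\<in>{..<n}. f i \<omega>) \<in> S}"
    if S: "S \<in> sets (borel_power n)" and f: "\<forall>i<n. f i \<in> \<alpha> (a i)" for n a S f
  proof -
    have F: "(\<lambda>\<omega>. \<lambda>i\<in>{..<n}. f i \<omega>) \<in> M \<rightarrow>\<^sub>M borel_power n"
      using f representative_measurable by (intro measurable_restrict) auto
    have "centered_gaussian_law n (\<lambda>i j. inner (a i) (a j)) = distr M (borel_power n) (\<lambda>\<omega>. \<lambda>i\<in>{..<n}. f i \<omega>)"
      using f by (intro centered_gaussian_law_eq joint_law_is_centered_gaussian) auto
    then show ?thesis
      using S F by (simp add: emeasure_distr vimage_def Int_def conj_commute)
  qed
  obtain n a S f where pres: "n \<ge> 1" "S \<in> sets (borel_power n)" "\<forall>i<n. f i \<in> \<alpha> (a i)"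
    "A = cylinder n a S" "E = {\<omega> \<in> space M. (\<lambda>i\<in>{..<n}. f i \<omega>) \<in> S}"
    using assms by (auto simp: represents_def)
  show ?thesis
    unfolding gaussian_additive_def
  proof (rule the_equality)
    show "\<exists>n a S. n \<ge> 1 \<and> S \<in> sets (borel_power n) \<and> A = cylinder n a S \<and>
        emeasure M E = emeasure (centered_gaussian_law n (\<lambda>i j. inner (a i) (a j))) S"
      by (intro exI[of _ n] exI[of _ a] exI[of _ S] conjI pres(1,2,4)) (simp only: pres(5) law[OF pres(2,3)])
    fix r assume "\<exists>n a S. n \<ge> 1 \<and> S \<in> sets (borel_power n) \<and> A = cylinder n a S \<and>
        r = emeasure (centered_gaussian_law n (\<lambda>i j. inner (a i) (a j))) S"
    then obtain m b T where b: "m \<ge> 1" "T \<in> sets (borel_power m)" "A = cylinder m b T"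
      and r: "r = emeasure (centered_gaussian_law m (\<lambda>i j. inner (b i) (b j))) T" by blast
    obtain h where h: "\<And>c. h c \<in> \<alpha> c" using representative_exists by metis
    let ?F = "{\<omega> \<in> space M. (\<lambda>i\<in>{..<m}. h (b i) \<omega>) \<in> T}"
    have F: "represents A ?F"
      unfolding represents_def using b h
      by (intro exI[of _ m] exI[of _ b] exI[of _ T] exI[of _ "\<lambda>i. h (b i)"]) auto
    have "r = emeasure M ?F" unfolding r using b(2) h by (intro law) auto
    also have "\<dots> = null_quotient_measure M (null_class M ?F)"
      using represents_measurable[OF F] by (simp add: null_quotient_measure_class)
    also have "null_class M ?F = null_class M E" by (rule represents_class_unique[OF F assms])
    also have "null_quotient_measure M (null_class M E) = emeasure M E"
      using represents_measurable[OF assms] by (simp add: null_quotient_measure_class)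
    finally show "r = emeasure M E" .
  qed
qed

lemma cylinder_class_morphism: "boolean_morphism cylinder_algebra (null_quotient M) cylinder_class"
  unfolding boolean_morphism_def
proof (intro conjI ballI impI)
  let ?B = "cylinder_algebra :: 'h set gorder"
  note lat = cylinder_algebra_lattice
  interpret cyl: algebra UNIV "carrier ?B" by (rule algebra_cylinders)
  \<comment> \<open>The cylinders \<open>{}\<close> and \<open>UNIV\<close>, for which membership does not depend on the point.\<close>
  have const_class: "cylinder_class A = null_class M E"
    if A: "A \<in> carrier ?B" and E: "E \<in> sets M" "\<And>\<omega> x. \<omega> \<in> space M \<Longrightarrow> \<omega> \<in> E \<longleftrightarrow> x \<in> A" for A E
  proof -
    obtain F where F: "represents A F" using represents_exists[OF A] .
    obtain x where "AE \<omega> in M. \<forall>(A, E)\<in>{(A, F)}. \<omega> \<in> E \<longleftrightarrow> x \<omega> \<in> A"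
      using represents_sampled[of "{(A, F)}"] F by auto
    then have "AE \<omega> in M. \<omega> \<in> F \<longleftrightarrow> \<omega> \<in> E"
      using AE_space by eventually_elim (use E(2) in auto)
    then show ?thesis
      using cylinder_class_eq[OF F] E(1) by (simp add: null_class_eq_iff represents_measurable[OF F])
  qed
  show "cylinder_class \<in> carrier ?B \<rightarrow> carrier (null_quotient M)"
  proof
    fix A assume "A \<in> carrier ?B"
    then obtain E where E: "represents A E" by (rule represents_exists)
    then show "cylinder_class A \<in> carrier (null_quotient M)"
      by (simp add: cylinder_class_eq represents_measurable)
  qed
  show "cylinder_class \<bottom>\<^bsub>?B\<^esub> = \<bottom>\<^bsub>null_quotient M\<^esub>"
    unfolding lat null_class_bottom by (intro const_class) auto
  show "cylinder_class \<top>\<^bsub>?B\<^esub> = \<top>\<^bsub>null_quotient M\<^esub>"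
    unfolding lat null_class_top by (intro const_class) auto
  fix A assume A: "A \<in> carrier ?B"
  then obtain E where E: "represents A E" by (rule represents_exists)
  obtain G where G: "represents (UNIV - A) G" using represents_exists[OF cyl.compl_sets[OF A]] .
  obtain x where "AE \<omega> in M. \<forall>(A, E)\<in>{(A, E), (UNIV - A, G)}. \<omega> \<in> E \<longleftrightarrow> x \<omega> \<in> A"
    using represents_sampled[of "{(A, E), (UNIV - A, G)}"] E G by auto
  then have "AE \<omega> in M. \<omega> \<in> G \<longleftrightarrow> \<omega> \<in> space M - E"
    using AE_space by eventually_elim auto
  then show "cylinder_class (lattice_compl ?B A) = lattice_compl (null_quotient M) (cylinder_class A)"
    using null_class_eq_iff[OF represents_measurable[OF G] sets.compl_sets[OF represents_measurable[OF E]]]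
    by (simp only: lat(5)[OF A] cylinder_class_eq[OF E] cylinder_class_eq[OF G]
        null_class_compl[OF represents_measurable[OF E]])
  fix A' assume A': "A' \<in> carrier ?B"
  then obtain E' where E': "represents A' E'" by (rule represents_exists)
  obtain U where U: "represents (A \<union> A') U" using represents_exists[OF cyl.Un[OF A A']] .
  obtain x where x: "AE \<omega> in M. \<forall>(A, E)\<in>{(A, E), (A', E'), (A \<union> A', U)}. \<omega> \<in> E \<longleftrightarrow> x \<omega> \<in> A"
    using represents_sampled[of "{(A, E), (A', E'), (A \<union> A', U)}"] E E' U by auto
  then have "AE \<omega> in M. \<omega> \<in> U \<longleftrightarrow> \<omega> \<in> E \<union> E'" by eventually_elim auto
  then show "cylinder_class (A \<squnion>\<^bsub>?B\<^esub> A') = cylinder_class A \<squnion>\<^bsub>null_quotient M\<^esub> cylinder_class A'"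
    using null_class_eq_iff[OF represents_measurable[OF U]
        sets.Un[OF represents_measurable[OF E] represents_measurable[OF E']]]
    by (simp only: lat(4)[OF A A'] cylinder_class_eq[OF E] cylinder_class_eq[OF E'] cylinder_class_eq[OF U]
        null_class_join[OF represents_measurable[OF E] represents_measurable[OF E']])
  assume "A \<sqsubseteq>\<^bsub>?B\<^esub> A'"
  then have "A \<subseteq> A'" by (simp add: cylinder_algebra_def)
  from x have "AE \<omega> in M. \<omega> \<in> E \<longrightarrow> \<omega> \<in> E'" by eventually_elim (use \<open>A \<subseteq> A'\<close> in auto)
  then show "cylinder_class A \<sqsubseteq>\<^bsub>null_quotient M\<^esub> cylinder_class A'"
    using E E' by (simp add: cylinder_class_eq represents_measurable null_class_le_iff)
qed

text \<open>The events that generate the sigma-algebra are those of cylinders over one vector.\<close>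

lemma null_quotient_generated_by_cylinders:
  "sigma_generated_by (null_quotient M) (cylinder_class ` carrier cylinder_algebra)"
proof (rule sigma_generated_by_mono[OF null_quotient_generated[OF generates]], safe)
  fix f S h assume f: "f \<in> \<alpha> h" and S: "S \<in> sets (borel :: real measure)"
  let ?T = "(\<lambda>y. y 0) -` S \<inter> space (borel_power 1)"
  have T: "?T \<in> sets (borel_power 1)"
    using borel_measurable_coordinate[of "borel_power 1" "{..<1}" 0] S by (auto intro: measurable_sets)
  have "represents (cylinder 1 (\<lambda>_. h) ?T) (f -` S \<inter> space M)"
    unfolding represents_def using f T
    by (intro exI[of _ 1] exI[of _ "\<lambda>_. h"] exI[of _ ?T] exI[of _ "\<lambda>_. f"]) (auto simp: space_PiM)
  then have "null_class M (f -` S \<inter> space M) = cylinder_class (cylinder 1 (\<lambda>_. h) ?T)"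
    by (rule cylinder_class_eq[symmetric])
  then show "null_class M (f -` S \<inter> space M) \<in> cylinder_class ` carrier cylinder_algebra"
    by (rule image_eqI) (rule cylinder_in_carrier[OF _ T], simp)
qed

theorem null_quotient_associated:
  "associated_reduced_algebra cylinder_algebra gaussian_additive
     (null_quotient M) (null_quotient_measure M) cylinder_class"
  unfolding associated_reduced_algebra_def
proof (intro conjI ballI null_quotient_reduced cylinder_class_morphism null_quotient_generated_by_cylinders)
  fix A :: "'h set" assume "A \<in> carrier cylinder_algebra"
  then obtain E where E: "represents A E" by (rule represents_exists)
  then show "null_quotient_measure M (cylinder_class A) = gaussian_additive A"
    by (simp add: cylinder_class_eq gaussian_additive_eq null_quotient_measure_class represents_measurable)
qed

lemma gaussian_additive_finite:
  fixes A :: "'h set"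
  assumes "A \<in> carrier cylinder_algebra"
  shows "gaussian_additive A \<noteq> \<infinity>"
proof -
  obtain E where "represents A E" using represents_exists[OF assms] .
  then show ?thesis by (simp add: gaussian_additive_eq emeasure_eq_measure)
qed

end

section \<open>The completion of the cylinder algebra\<close>

theorem theorem16:
  fixes M :: "'x measure"
    and \<alpha> :: "'h::{real_inner, complete_space} \<Rightarrow> ('x \<Rightarrow> real) set"
    and L :: "'b gorder"
    and \<mu> :: "'b \<Rightarrow> ennreal"
    and \<beta> :: "'h set \<Rightarrow> 'b"
  assumes "gaussian_probability_space M \<alpha>"
    and "associated_reduced_algebra cylinder_algebra gaussian_additive L \<mu> \<beta>"
  shows "\<exists>!\<phi>. \<phi> \<in> extensional (carrier L) \<and>
    reduced_sigma_algebra_iso L \<mu> (null_quotient M) (null_quotient_measure M) \<phi> \<and>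
    (\<forall>n a S f. n \<ge> 1 \<and> S \<in> sets (borel_power n) \<and> (\<forall>i<n. f i \<in> \<alpha> (a i)) \<longrightarrow>
       \<phi> (\<beta> (cylinder n a S)) =
         null_class M {\<omega> \<in> space M. (\<lambda>i\<in>{..<n}. f i \<omega>) \<in> S})"
proof -
  interpret gaussian_probability_space M \<alpha> by fact
  have "\<top>\<^bsub>cylinder_algebra\<^esub> \<in> carrier (cylinder_algebra :: 'h set gorder)"
    using algebra.top[OF algebra_cylinders] by (simp add: cylinder_algebra_lattice)
  note unique = associated_reduced_algebra_unique[OF cylinder_algebra_lattice(1)
      gaussian_additive_finite[OF this] assms(2) null_quotient_associated]
  have "(\<forall>A\<in>carrier cylinder_algebra. \<phi> (\<beta> A) = cylinder_class A) \<longleftrightarrow>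
    (\<forall>n a S f. n \<ge> 1 \<and> S \<in> sets (borel_power n) \<and> (\<forall>i<n. f i \<in> \<alpha> (a i)) \<longrightarrow>
       \<phi> (\<beta> (cylinder n a S)) = null_class M {\<omega> \<in> space M. (\<lambda>i\<in>{..<n}. f i \<omega>) \<in> S})" (is "?L \<longleftrightarrow> ?R") for \<phi>
  proof
    assume L: ?L
    show ?R
    proof (intro allI impI)
      fix n a S f assume *: "n \<ge> 1 \<and> S \<in> sets (borel_power n) \<and> (\<forall>i<n. f i \<in> \<alpha> (a i))"
      then have "represents (cylinder n a S) {\<omega> \<in> space M. (\<lambda>i\<in>{..<n}. f i \<omega>) \<in> S}"
        unfolding represents_def by blast
      then show "\<phi> (\<beta> (cylinder n a S)) = null_class M {\<omega> \<in> space M. (\<lambda>i\<in>{..<n}. f i \<omega>) \<in> S}"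
        using L * by (simp add: cylinder_in_carrier cylinder_class_eq)
    qed
  next
    assume R: ?R
    show ?L
    proof
      fix A :: "'h set" assume "A \<in> carrier cylinder_algebra"
      then obtain E where E: "represents A E" by (rule represents_exists)
      then have "\<phi> (\<beta> A) = null_class M E" using R unfolding represents_def by blast
      then show "\<phi> (\<beta> A) = cylinder_class A" using cylinder_class_eq[OF E] by simp
    qed
  qed
  then show ?thesis using unique by simp
qed

end
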